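(* Let $\kappa$ be a signature wavelet and let $\sigma$ denote the signature with respect to $\kappa$. Let $f:\mathbb{R}\to\mathbb{R}$ be a locally integrable function of polynomial growth, let $b\in\mathbb{R}$ and $\gamma\in(0,1]$. If $f$ has a symmetric cusp singularity of order $\gamma$ at $b$, then $$\sigma f(b)=\begin{cases}+1,&\text{for an upward cusp},\\ -1,&\text{for a downward cusp}.\end{cases}$$ If $f$ has a one-sided cusp of order $\gamma$ at $b$, then $$\sigma f(b)=\begin{cases}e^{+i(\gamma+1)\pi/2},&\text{for a right hand cusp},\\ e^{-i(\gamma+1)\pi/2},&\text{for a left hand cusp}.\end{cases}$$
   Context: The Fourier transform is $\widehat f(\omega)=\int_{\mathbb{R}}e^{-i\omega x}f(x)\,dx$. A signature wavelet is a non-zero complex-valued Schwartz function $\kappa\in\mathscr{S}(\mathbb{R},\mathbb{C})$ such that $\operatorname{supp}\widehat\kappa\subseteq[c,d]$ for some $0<c<d<\infty$ and $\widehat\kappa(\omega)\ge 0$ for all $\omega\in\mathbb{R}$. For $a>0$, $b\in\mathbb{R}$ put $\kappa_{a,b}(x)=\frac{1}{\sqrt a}\,\kappa\left(\frac{x-b}{a}\right)$. The pairing $\langle f,\phi\rangle$ of a tempered distribution with a Schwartz function is bilinear (no complex conjugation), i.e. $\langle f,\phi\rangle=\int f\phi\,dx$ for functions $f$. For $z\in\mathbb{C}\setminus\{0\}$, $\operatorname{sgn} z=z/|z|$, and $\operatorname{sgn}0=0$. The signature of $f$ at $b$ (with respect to $\kappa$) is $\sigma f(b)=\lim_{a\to0+}\operatorname{sgn}\langle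 f,\kappa_{a,b}\rangle$ if this limit exists in $\mathbb{C}$, and $\sigma f(b)=0$ otherwise. A function $f$ is of polynomial growth if there is $N\in\mathbb{N}$ with $f\in O(|x|^N)$ as $|x|\to\infty$. Cusps. $f$ has a symmetric cusp singularity of order $\gamma\in(0,1]$ at $x_0\in\mathbb{R}$ if $f(x)=\pm|x-x_0|^\gamma(1+g(x))$, where $g$ is a locally integrable function with $\lim_{x\to x_0}g(x)=0$; the cusp is downward if the sign is $+$ and upward if the sign is $-$. With $x_+^\gamma=x^\gamma$ for $x\ge0$ and $x_+^\gamma=0$ otherwise, $f$ has a right hand cusp of order $\gamma\in(0,1]$ at $x_0$ if $f(x)=(x-x_0)_+^\gamma(1+g(x))$ with $g$ locally integrable and $\lim_{x\to x_0}g(x)=0$. The reversed version, $f(x)=(x_0-x)_+^\gamma(1+g(x))$ with $g$ as before, is called a left hand cusp. A one-sided cusp is a right hand or a left hand cusp. *)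

theory Defs
  imports "HOL-Analysis.Analysis" "HOL-Library.Landau_Symbols"
begin

definition vderiv :: "nat \<Rightarrow> (real \<Rightarrow> complex) \<Rightarrow> real \<Rightarrow> complex" where
  "vderiv n \<phi> = ((\<lambda>g x. vector_derivative g (at x)) ^^ n) \<phi>"

definition schwartz :: "(real \<Rightarrow> complex) \<Rightarrow> bool" where
  "schwartz \<phi> \<longleftrightarrow>
     (\<forall>n x. vderiv n \<phi> differentiable (at x)) \<and>
     (\<forall>m n. bounded (range (\<lambda>x. x ^ m *\<^sub>R vderiv n \<phi> x)))"

definition fourier :: "(real \<Rightarrow> complex) \<Rightarrow> real \<Rightarrow> complex" where
  "fourier f \<omega> = (LINT x|lebesgue. exp (- \<i> * of_real (\<omega> * x)) * f x)"

definition signature_wavelet :: "(real \<Rightarrow> complex) \<Rightarrow> bool" where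
  "signature_wavelet \<kappa> \<longleftrightarrow>
     schwartz \<kappa> \<and> (\<exists>x. \<kappa> x \<noteq> 0) \<and>
     (\<exists>c d. 0 < c \<and> c < d \<and> closure {\<omega>. fourier \<kappa> \<omega> \<noteq> 0} \<subseteq> {c..d}) \<and>
     (\<forall>\<omega>. fourier \<kappa> \<omega> \<in> \<real>\<^sub>\<ge>\<^sub>0)"

definition wavelet_dilate :: "(real \<Rightarrow> complex) \<Rightarrow> real \<Rightarrow> real \<Rightarrow> real \<Rightarrow> complex" where
  "wavelet_dilate \<kappa> a b x = of_real (1 / sqrt a) * \<kappa> ((x - b) / a)"

text \<open>
  A distribution is represented by its pairing \<open>u \<phi>\<close> with test functions
  \<open>\<phi>\<close>; the pairing is bilinear, without complex conjugation. Values of \<open>u\<close> at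
  functions that are not Schwartz functions are never used.
\<close>

definition regular_distribution ::
    "(real \<Rightarrow> complex) \<Rightarrow> (real \<Rightarrow> complex) \<Rightarrow> complex" where
  "regular_distribution f \<phi> = (LINT x|lebesgue. f x * \<phi> x)"

definition signature ::
    "(real \<Rightarrow> complex) \<Rightarrow> ((real \<Rightarrow> complex) \<Rightarrow> complex) \<Rightarrow> real \<Rightarrow> complex" where
  "signature \<kappa> u b =
     (if \<exists>l. ((\<lambda>a. sgn (u (wavelet_dilate \<kappa> a b))) \<longlongrightarrow> l) (at_right 0)
      then Lim (at_right 0) (\<lambda>a. sgn (u (wavelet_dilate \<kappa> a b)))
      else 0)"

definition locally_integrable :: "(real \<Rightarrow> real) \<Rightarrow> bool" where
  "locally_integrable f \<longleftrightarrow> (\<forall>K. compact K \<longrightarrow> f absolutely_integrable_on K)"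

definition polynomial_growth :: "(real \<Rightarrow> real) \<Rightarrow> bool" where
  "polynomial_growth f \<longleftrightarrow> (\<exists>N::nat. f \<in> O[at_infinity](\<lambda>x. \<bar>x\<bar> ^ N))"

definition pos_part_powr :: "real \<Rightarrow> real \<Rightarrow> real" where
  "pos_part_powr x \<gamma> = (if x \<ge> 0 then x powr \<gamma> else 0)"

text \<open>
  The value \<open>g x\<^sub>0\<close> is irrelevant below, since the factor multiplying
  \<open>1 + g x\<close> vanishes at \<open>x\<^sub>0\<close>; so it makes no difference that the limit of \<open>g\<close>
  is the punctured one. The representations of \<open>f\<close> hold on the whole real line.
\<close>

definition downward_cusp :: "(real \<Rightarrow> real) \<Rightarrow> real \<Rightarrow> real \<Rightarrow> bool" where
  "downward_cusp f \<gamma> x\<^sub>0 \<longleftrightarrow> 0 < \<gamma> \<and> \<gamma> \<le> 1 \<and>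
     (\<exists>g. locally_integrable g \<and> (g \<longlongrightarrow> 0) (at x\<^sub>0) \<and>
          (\<forall>x. f x = \<bar>x - x\<^sub>0\<bar> powr \<gamma> * (1 + g x)))"

definition upward_cusp :: "(real \<Rightarrow> real) \<Rightarrow> real \<Rightarrow> real \<Rightarrow> bool" where
  "upward_cusp f \<gamma> x\<^sub>0 \<longleftrightarrow> 0 < \<gamma> \<and> \<gamma> \<le> 1 \<and>
     (\<exists>g. locally_integrable g \<and> (g \<longlongrightarrow> 0) (at x\<^sub>0) \<and>
          (\<forall>x. f x = - (\<bar>x - x\<^sub>0\<bar> powr \<gamma> * (1 + g x))))"

definition right_hand_cusp :: "(real \<Rightarrow> real) \<Rightarrow> real \<Rightarrow> real \<Rightarrow> bool" where
  "right_hand_cusp f \<gamma> x\<^sub>0 \<longleftrightarrow> 0 < \<gamma> \<and> \<gamma> \<le> 1 \<and>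
     (\<exists>g. locally_integrable g \<and> (g \<longlongrightarrow> 0) (at x\<^sub>0) \<and>
          (\<forall>x. f x = pos_part_powr (x - x\<^sub>0) \<gamma> * (1 + g x)))"

definition left_hand_cusp :: "(real \<Rightarrow> real) \<Rightarrow> real \<Rightarrow> real \<Rightarrow> bool" where
  "left_hand_cusp f \<gamma> x\<^sub>0 \<longleftrightarrow> 0 < \<gamma> \<and> \<gamma> \<le> 1 \<and>
     (\<exists>g. locally_integrable g \<and> (g \<longlongrightarrow> 0) (at x\<^sub>0) \<and>
          (\<forall>x. f x = pos_part_powr (x\<^sub>0 - x) \<gamma> * (1 + g x)))"

end

theory Submission
  imports Defs "HOL-Probability.Characteristic_Functions" "HOL-Probability.Sinc_Integral"
    "HOL-Real_Asymp.Real_Asymp"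
begin

text \<open>
  At a cusp, \<open>f\<close> equals a homogeneous function \<open>h (x - b)\<close> of degree \<open>\<gamma>\<close> up to a factor tending to
  one. Rescaling shows that the pairing of \<open>f\<close> with the wavelet at scale \<open>a\<close>, divided by
  \<open>a powr (\<gamma> + 1 / 2)\<close>, tends to the moment \<open>\<integral> h(y) \<kappa>(y) dy\<close>; this is \<open>pairing_asymptotics\<close>, and it uses
  the rapid decay of \<open>\<kappa>\<close> to suppress everything away from \<open>b\<close>. As soon as the moment is nonzero, the
  signature is its \<open>sgn\<close>, by \<open>signature_eq_sgn\<close>.

  It remains to find the phase of the moments. By Fourier inversion \<open>\<kappa>\<close> is a superposition of
  exponentials \<open>exp (\<i> \<omega> y)\<close> with nonnegative weights and frequencies \<open>\<omega> > 0\<close>. For a single frequency,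
  \<open>\<integral>\<^sub>0\<^sup>\<infinity> y\<^sup>\<gamma> exp (\<i> \<omega> y) dy\<close> is, in the sense of Abel summation,
  \<open>\<Gamma>(\<gamma> + 1) \<omega> powr (- (\<gamma> + 1))\<close> times \<open>exp (\<i> (\<gamma> + 1) \<pi> / 2)\<close>: the phase is the same for all
  \<open>\<omega> > 0\<close>, and the modulus is positive. Hence the moment of the right hand cusp has exactly this phase
  (\<open>pos_part_moment_polar\<close>). Reflection conjugates moments, because the spectrum is real; this gives
  the left hand cusp. The symmetric cusp is the sum of both, a positive multiple of
  \<open>cos ((\<gamma> + 1) \<pi> / 2)\<close>, which is negative for \<open>0 < \<gamma> \<le> 1\<close>.
\<close>

section \<open>Fourier inversion\<close>

lemma Fubini_product_bound:
  fixes F :: "real \<Rightarrow> real \<Rightarrow> complex" and u v :: "real \<Rightarrow> real"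
  assumes [measurable]: "(\<lambda>(x, y). F x y) \<in> borel_measurable (lborel \<Otimes>\<^sub>M lborel)"
    and u: "integrable lborel u" and v: "integrable lborel v"
    and le: "\<And>x y. norm (F x y) \<le> u x * v y"
  shows "(LINT y|lborel. LINT x|lborel. F x y) = (LINT x|lborel. LINT y|lborel. F x y)"
proof -
  have [measurable]: "u \<in> borel_measurable borel" "v \<in> borel_measurable borel"
    using u v by (auto dest: borel_measurable_integrable)
  have "integrable (lborel \<Otimes>\<^sub>M lborel) (\<lambda>(x, y). u x * v y)"
    by (rule lborel_pair.Fubini_integrable) (auto simp: abs_mult u v)
  moreover have "norm (F x y) \<le> norm (u x * v y)" for x y
    using le[of x y] by simp
  ultimately have "integrable (lborel \<Otimes>\<^sub>M lborel) (\<lambda>(x, y). F x y)"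
    by - (rule Bochner_Integration.integrable_bound, auto)
  then show ?thesis by (rule lborel_pair.Fubini_integral)
qed

lemma fourier_lborel:
  assumes "f \<in> borel_measurable borel"
  shows "fourier f \<omega> = (LINT x|lborel. iexp (- (\<omega> * x)) * f x)"
  unfolding fourier_def using assms by (subst integral_completion) auto

lemma borel_measurable_fourier:
  assumes [measurable]: "f \<in> borel_measurable borel"
  shows "fourier f \<in> borel_measurable borel"
proof -
  have "(\<lambda>\<omega>. LINT x|lborel. iexp (- (\<omega> * x)) * f x) \<in> borel_measurable borel"
    by (rule lborel.borel_measurable_lebesgue_integral) measurable
  then show ?thesis using assms by (simp add: fourier_lborel cong: measurable_cong)
qed

text \<open>
  The Gaussian is, up to a constant, its own Fourier transform. In this form it lets a Gaussian
  weight be traded for an integral of exponentials.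
\<close>

lemma std_normal_density_fourier:
  "complex_of_real (exp (- (t\<^sup>2) / 2)) = (LINT \<tau>|lborel. std_normal_density \<tau> * iexp (t * \<tau>))"
proof -
  have "complex_of_real (exp (- (t\<^sup>2) / 2)) = char std_normal_distribution t"
    by (simp add: char_std_normal_distribution)
  also have "\<dots> = (LINT \<tau>|lborel. std_normal_density \<tau> * iexp (t * \<tau>))"
    unfolding char_def by (subst integral_density) (auto simp: scaleR_conv_of_real)
  finally show ?thesis .
qed

text \<open>
  Writing the Gaussian on the left as an integral of exponentials and exchanging the two
  integrations turns the inner integral into a value of the Fourier transform of \<open>f\<close>. Both sides
  converge as \<open>\<epsilon>\<close> tends to zero, the left one because \<open>f\<close> is continuous, the right one because the
  transform is integrable, whereas \<open>\<omega> \<mapsto> fourier f \<omega> * iexp (\<omega> * x)\<close> cannot be treated by exchanging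
  integrations directly.
\<close>

lemma fourier_inversion_mollified:
  fixes f :: "real \<Rightarrow> complex"
  assumes int: "integrable lborel f" and "0 < \<epsilon>"
  shows "(LINT t|lborel. f (x + \<epsilon> * t) * complex_of_real (exp (- (t\<^sup>2) / 2)))
       = (LINT \<omega>|lborel. std_normal_density (\<epsilon> * \<omega>) * (fourier f \<omega> * iexp (\<omega> * x)))"
proof -
  have [measurable]: "f \<in> borel_measurable borel" using int by auto
  have int': "integrable lborel (\<lambda>t. f (x + \<epsilon> * t))"
    using int \<open>0 < \<epsilon>\<close> by (intro lborel_integrable_real_affine) auto
  have inner: "(LINT t|lborel. f (x + \<epsilon> * t) * iexp (t * (\<epsilon> * - \<omega>))) = 1 / \<epsilon> * (fourier f \<omega> * iexp (\<omega> * x))" for \<omega>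
  proof -
    have "fourier f \<omega> = \<bar>\<epsilon>\<bar> *\<^sub>R (LINT t|lborel. iexp (- (\<omega> * (x + \<epsilon> * t))) * f (x + \<epsilon> * t))"
      using \<open>0 < \<epsilon>\<close> by (subst fourier_lborel, simp, subst lborel_integral_real_affine[of \<epsilon> _ x]) auto
    then have "1 / \<epsilon> * (fourier f \<omega> * iexp (\<omega> * x))
        = (LINT t|lborel. iexp (- (\<omega> * (x + \<epsilon> * t))) * f (x + \<epsilon> * t)) * iexp (\<omega> * x)"
      using \<open>0 < \<epsilon>\<close> by (simp add: scaleR_conv_of_real)
    also have "\<dots> = (LINT t|lborel. iexp (- (\<omega> * (x + \<epsilon> * t))) * f (x + \<epsilon> * t) * iexp (\<omega> * x))"
      by simp
    also have "\<dots> = (LINT t|lborel. f (x + \<epsilon> * t) * iexp (t * (\<epsilon> * - \<omega>)))"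
    proof (rule Bochner_Integration.integral_cong[OF refl])
      fix t
      have "iexp (- (\<omega> * (x + \<epsilon> * t))) * iexp (\<omega> * x) = iexp (t * (\<epsilon> * - \<omega>))"
        by (simp add: exp_add[symmetric] algebra_simps)
      then show "iexp (- (\<omega> * (x + \<epsilon> * t))) * f (x + \<epsilon> * t) * iexp (\<omega> * x) = f (x + \<epsilon> * t) * iexp (t * (\<epsilon> * - \<omega>))"
        by (metis mult.assoc mult.commute)
    qed
    finally show ?thesis by simp
  qed
  have "(LINT t|lborel. f (x + \<epsilon> * t) * complex_of_real (exp (- (t\<^sup>2) / 2)))
      = (LINT t|lborel. LINT \<tau>|lborel. f (x + \<epsilon> * t) * (std_normal_density \<tau> * iexp (t * \<tau>)))"
    by (subst integral_mult_right_zero) (simp only: std_normal_density_fourier)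
  also have "\<dots> = (LINT \<tau>|lborel. LINT t|lborel. f (x + \<epsilon> * t) * (std_normal_density \<tau> * iexp (t * \<tau>)))"
    by (rule Fubini_product_bound[where u = "std_normal_density" and v = "\<lambda>t. norm (f (x + \<epsilon> * t))"])
       (use int' in \<open>auto simp: norm_mult integrable_normal_density mult.commute\<close>)
  also have "\<dots> = (LINT \<tau>|lborel. std_normal_density \<tau> * (LINT t|lborel. f (x + \<epsilon> * t) * iexp (t * \<tau>)))"
    by (subst integral_mult_right_zero[symmetric]) (simp add: mult_ac)
  \<comment> \<open>The frequency variable is \<open>\<omega> = - \<tau> / \<epsilon>\<close>; the sign turns \<open>iexp (t * \<tau>)\<close> into the kernel of the transform.\<close>
  also have "\<dots> = \<bar>- \<epsilon>\<bar> *\<^sub>R (LINT \<omega>|lborel. std_normal_density (0 + - \<epsilon> * \<omega>) *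
        (LINT t|lborel. f (x + \<epsilon> * t) * iexp (t * (0 + - \<epsilon> * \<omega>))))"
    using \<open>0 < \<epsilon>\<close> by (subst lborel_integral_real_affine[of "- \<epsilon>" _ 0]) auto
  also have "\<dots> = \<epsilon> * (LINT \<omega>|lborel. std_normal_density (\<epsilon> * \<omega>) * (1 / \<epsilon> * (fourier f \<omega> * iexp (\<omega> * x))))"
    using \<open>0 < \<epsilon>\<close> inner by (simp add: scaleR_conv_of_real std_normal_density_def)
  also have "\<dots> = (LINT \<omega>|lborel. std_normal_density (\<epsilon> * \<omega>) * (fourier f \<omega> * iexp (\<omega> * x)))"
    using \<open>0 < \<epsilon>\<close> by (subst integral_mult_right_zero[symmetric]) (simp add: mult_ac)
  finally show ?thesis .
qed

lemma fourier_inversion: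
  fixes f :: "real \<Rightarrow> complex"
  assumes cont: "continuous_on UNIV f" and bdd: "bounded (range f)"
    and int: "integrable lborel f" and int': "integrable lborel (fourier f)"
  shows "(LINT \<omega>|lborel. fourier f \<omega> * iexp (\<omega> * x)) = 2 * pi * f x"
proof -
  define \<epsilon> where "\<epsilon> n = inverse (real (Suc n))" for n
  have \<epsilon>: "\<epsilon> \<longlonglongrightarrow> 0" "\<And>n. 0 < \<epsilon> n"
    unfolding \<epsilon>_def by (rule LIMSEQ_inverse_real_of_nat) simp
  have [measurable]: "f \<in> borel_measurable borel" "fourier f \<in> borel_measurable borel"
    using int int' by auto
  obtain B where B: "\<And>x. norm (f x) \<le> B" using bdd by (auto simp: bounded_iff)
  have gauss: "integrable lborel (\<lambda>t. exp (- (t\<^sup>2) / 2) :: real)"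
    "(LINT t|lborel. exp (- (t\<^sup>2) / 2)) = sqrt (2 * pi)"
  proof -
    have eq: "exp (- (t\<^sup>2) / 2) = sqrt (2 * pi) * std_normal_density t" for t :: real
      by (simp add: std_normal_density_def)
    show "integrable lborel (\<lambda>t. exp (- (t\<^sup>2) / 2) :: real)"
      unfolding eq by (intro integrable_mult_right integrable_normal_density) simp
    show "(LINT t|lborel. exp (- (t\<^sup>2) / 2)) = sqrt (2 * pi)"
      unfolding eq by simp
  qed
  have "(\<lambda>n. LINT t|lborel. f (x + \<epsilon> n * t) * complex_of_real (exp (- (t\<^sup>2) / 2)))
      \<longlonglongrightarrow> (LINT t|lborel. f x * complex_of_real (exp (- (t\<^sup>2) / 2)))"
  proof (rule integral_dominated_convergence)
    show "integrable lborel (\<lambda>t. B * exp (- (t\<^sup>2) / 2) :: real)" by (intro integrable_mult_right gauss)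
    show "AE t in lborel. (\<lambda>n. f (x + \<epsilon> n * t) * complex_of_real (exp (- (t\<^sup>2) / 2))) \<longlonglongrightarrow> f x * complex_of_real (exp (- (t\<^sup>2) / 2))"
    proof (intro AE_I2 tendsto_mult tendsto_const)
      fix t
      have "(\<lambda>n. x + \<epsilon> n * t) \<longlonglongrightarrow> x" by (auto intro!: tendsto_eq_intros \<epsilon>)
      with cont show "(\<lambda>n. f (x + \<epsilon> n * t)) \<longlonglongrightarrow> f x"
        by (auto simp: continuous_on_eq_continuous_at intro: isCont_tendsto_compose)
    qed
    show "AE t in lborel. norm (f (x + \<epsilon> n * t) * complex_of_real (exp (- (t\<^sup>2) / 2))) \<le> B * exp (- (t\<^sup>2) / 2)" for n
      by (auto intro!: AE_I2 mult_right_mono B simp: norm_mult)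
  qed auto
  moreover have "(\<lambda>n. LINT \<omega>|lborel. std_normal_density (\<epsilon> n * \<omega>) * (fourier f \<omega> * iexp (\<omega> * x)))
      \<longlonglongrightarrow> (LINT \<omega>|lborel. (1 / sqrt (2 * pi)) * (fourier f \<omega> * iexp (\<omega> * x)))"
  proof (rule integral_dominated_convergence)
    show "integrable lborel (\<lambda>\<omega>. (1 / sqrt (2 * pi)) * norm (fourier f \<omega>))"
      by (intro integrable_mult_right integrable_norm int')
    show "AE \<omega> in lborel. (\<lambda>n. std_normal_density (\<epsilon> n * \<omega>) * (fourier f \<omega> * iexp (\<omega> * x)))
        \<longlonglongrightarrow> (1 / sqrt (2 * pi)) * (fourier f \<omega> * iexp (\<omega> * x))"
    proof (intro AE_I2 tendsto_mult tendsto_const tendsto_of_real)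
      fix \<omega>
      show "(\<lambda>n. std_normal_density (\<epsilon> n * \<omega>)) \<longlonglongrightarrow> 1 / sqrt (2 * pi)"
        unfolding std_normal_density_def by (auto intro!: tendsto_eq_intros \<epsilon>)
    qed
    show "AE \<omega> in lborel. norm (std_normal_density (\<epsilon> n * \<omega>) * (fourier f \<omega> * iexp (\<omega> * x)))
        \<le> (1 / sqrt (2 * pi)) * norm (fourier f \<omega>)" for n
    proof (rule AE_I2)
      fix \<omega>
      have "std_normal_density (\<epsilon> n * \<omega>) \<le> 1 / sqrt (2 * pi)"
        by (simp add: std_normal_density_def divide_right_mono)
      then show "norm (std_normal_density (\<epsilon> n * \<omega>) * (fourier f \<omega> * iexp (\<omega> * x)))
        \<le> (1 / sqrt (2 * pi)) * norm (fourier f \<omega>)"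
        unfolding norm_mult by (intro mult_mono) (auto simp: norm_mult)
    qed
  qed auto
  ultimately have "(LINT t|lborel. f x * complex_of_real (exp (- (t\<^sup>2) / 2)))
      = (LINT \<omega>|lborel. (1 / sqrt (2 * pi)) * (fourier f \<omega> * iexp (\<omega> * x)))"
    using fourier_inversion_mollified[OF int \<epsilon>(2)] by (auto intro: LIMSEQ_unique)
  moreover have "(LINT t|lborel. complex_of_real (exp (- (t\<^sup>2) / 2))) = sqrt (2 * pi)"
    using gauss(2) by (simp only: integral_complex_of_real)
  ultimately have "f x * sqrt (2 * pi)
      = (1 / sqrt (2 * pi)) * (LINT \<omega>|lborel. fourier f \<omega> * iexp (\<omega> * x))"
    by (subst (asm) (1 2) integral_mult_right_zero) simp
  then have "complex_of_real (sqrt (2 * pi)) * (f x * sqrt (2 * pi))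
      = complex_of_real (sqrt (2 * pi)) * ((1 / sqrt (2 * pi)) * (LINT \<omega>|lborel. fourier f \<omega> * iexp (\<omega> * x)))"
    by simp
  moreover have "complex_of_real (sqrt (2 * pi)) * sqrt (2 * pi) = 2 * pi"
    by (simp flip: of_real_mult)
  ultimately show ?thesis by (simp add: mult_ac field_simps flip: of_real_mult)
qed

section \<open>The gamma integral with complex damping\<close>

lemma borel_measurable_pos_part_powr [measurable]: "(\<lambda>t. pos_part_powr t p) \<in> borel_measurable borel"
  unfolding pos_part_powr_def by measurable

lemma pos_part_powr_nonneg [simp]: "0 \<le> pos_part_powr t p"
  by (simp add: pos_part_powr_def)

lemma pos_part_powr_scale: "0 < a \<Longrightarrow> pos_part_powr (a * t) p = a powr p * pos_part_powr t p"
  by (auto simp: pos_part_powr_def powr_mult zero_le_mult_iff)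

lemma pos_part_powr_le: "pos_part_powr t p \<le> \<bar>t\<bar> powr p"
  by (simp add: pos_part_powr_def)

lemma integrable_damped_pos_part_powr:
  assumes "0 < p" "0 < \<epsilon>"
  shows "integrable lborel (\<lambda>t. pos_part_powr t p * exp (- (\<epsilon> * t)))"
proof -
  have "set_integrable lebesgue {0<..} (\<lambda>t. complex_of_real t powr (complex_of_real (p + 1) - 1) / of_real (exp (\<epsilon> * t)))"
    using assms by (intro absolutely_integrable_Gamma_integral) auto
  then have "integrable lebesgue (\<lambda>t. norm (indicator {0<..} t *\<^sub>R (complex_of_real t powr (complex_of_real (p + 1) - 1) / of_real (exp (\<epsilon> * t)))))"
    unfolding set_integrable_def by (rule integrable_norm)
  also have "(\<lambda>t. norm (indicator {0<..} t *\<^sub>R (complex_of_real t powr (complex_of_real (p + 1) - 1) / of_real (exp (\<epsilon> * t)))))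
      = (\<lambda>t. pos_part_powr t p * exp (- (\<epsilon> * t)))"
    using assms by (auto simp: fun_eq_iff pos_part_powr_def indicator_def norm_divide norm_mult norm_inverse norm_powr_real_powr exp_minus divide_inverse)
  finally show ?thesis by (subst (asm) integrable_completion) auto
qed

lemma integral_damped_pos_part_powr:
  assumes "0 < p" "0 < \<epsilon>"
  shows "(LINT t|lborel. pos_part_powr t p * exp (- (\<epsilon> * t))) = Gamma (p + 1) * \<epsilon> powr (- (p + 1))"
proof -
  have "((\<lambda>t. t powr (p + 1 - 1) / exp t) has_integral Gamma (p + 1)) {0..}"
    using assms by (intro Gamma_integral_real) auto
  then have "((\<lambda>t. if t \<in> {0..} then t powr (p + 1 - 1) / exp t else 0) has_integral Gamma (p + 1)) UNIV"
    by (simp only: has_integral_restrict_UNIV)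
  also have "(\<lambda>t. if t \<in> {0..} then t powr (p + 1 - 1) / exp t else 0) = (\<lambda>t. pos_part_powr t p * exp (- (1 * t)))"
    by (auto simp: pos_part_powr_def exp_minus divide_inverse)
  finally have "Gamma (p + 1) = (LINT t|lborel. pos_part_powr t p * exp (- (1 * t)))"
    using has_integral_integral_lborel[OF integrable_damped_pos_part_powr[OF assms(1), of 1]]
    by (intro has_integral_unique) auto
  also have "\<dots> = \<bar>\<epsilon>\<bar> *\<^sub>R (LINT t|lborel. pos_part_powr (0 + \<epsilon> * t) p * exp (- (1 * (0 + \<epsilon> * t))))"
    using assms by (intro lborel_integral_real_affine) auto
  also have "\<dots> = \<epsilon> * (LINT t|lborel. \<epsilon> powr p * (pos_part_powr t p * exp (- (\<epsilon> * t))))"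
    using assms by (simp add: pos_part_powr_scale mult.assoc)
  also have "\<dots> = \<epsilon> powr (p + 1) * (LINT t|lborel. pos_part_powr t p * exp (- (\<epsilon> * t)))"
    using assms by (simp add: powr_add)
  finally have "Gamma (p + 1) * \<epsilon> powr (- (p + 1)) = (\<epsilon> powr (p + 1) * \<epsilon> powr (- (p + 1)))
      * (LINT t|lborel. pos_part_powr t p * exp (- (\<epsilon> * t)))" by simp
  also have "\<epsilon> powr (p + 1) * \<epsilon> powr (- (p + 1)) = 1" using assms by (simp flip: powr_add)
  finally show ?thesis by simp
qed

text \<open>
  The gamma integral along the ray through \<open>\<epsilon> - \<i> \<omega>\<close>, that is, the Laplace transform of \<open>t powr p\<close>
  at this point. The damping by \<open>\<epsilon>\<close> makes it absolutely convergent; the boundary value at \<open>\<epsilon> = 0\<close>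
  exists only as a limit.
\<close>

definition damped_gamma :: "real \<Rightarrow> real \<Rightarrow> real \<Rightarrow> complex" where
  "damped_gamma \<epsilon> p \<omega> = (LINT t|lborel. of_real (pos_part_powr t p * exp (- (\<epsilon> * t))) * iexp (\<omega> * t))"

lemma integrable_damped_gamma:
  assumes "0 < p" "0 < \<epsilon>"
  shows "integrable lborel (\<lambda>t. of_real (pos_part_powr t p * exp (- (\<epsilon> * t))) * iexp (\<omega> * t))"
  by (rule Bochner_Integration.integrable_bound[OF integrable_damped_pos_part_powr[OF assms]])
     (auto simp: norm_mult)

text \<open>
  Integration by parts: the derivative of \<open>t powr (p + 1) * exp (- s * t)\<close> with \<open>s = \<epsilon> - \<i> \<omega>\<close>
  integrates to zero, since this function vanishes at both ends of the half-line.
\<close>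

lemma damped_gamma_recurrence:
  assumes "0 < p" "0 < \<epsilon>"
  shows "of_real (p + 1) * damped_gamma \<epsilon> p \<omega> = Complex \<epsilon> (- \<omega>) * damped_gamma \<epsilon> (p + 1) \<omega>"
proof -
  let ?s = "Complex \<epsilon> (- \<omega>)"
  define F where "F t = of_real (t powr (p + 1)) * exp (- (?s * of_real t))" for t
  define f where "f t = of_real (p + 1) * (of_real (pos_part_powr t p * exp (- (\<epsilon> * t))) * iexp (\<omega> * t))
     - ?s * (of_real (pos_part_powr t (p + 1) * exp (- (\<epsilon> * t))) * iexp (\<omega> * t))" for t
  have exp_s: "exp (- (?s * of_real t)) = of_real (exp (- (\<epsilon> * t))) * iexp (\<omega> * t)" for t
    by (simp add: complex_eq_iff exp_eq_polar Re_exp Im_exp cis.ctr)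
  have f_eq: "f t = (of_real ((p + 1) * t powr p) - ?s * of_real (t powr (p + 1))) * exp (- (?s * of_real t))" if "0 \<le> t" for t
    using that unfolding f_def exp_s by (simp add: pos_part_powr_def algebra_simps)
  have f_int: "integrable lborel f"
    unfolding f_def using assms
    by (intro Bochner_Integration.integrable_diff integrable_mult_right integrable_damped_gamma) auto
  have f_zero: "f t = 0" if "t \<le> 0" for t
    using that assms by (cases "t = 0") (auto simp: f_def pos_part_powr_def)
  have norm_F: "norm (F t) = t powr (p + 1) * exp (- (\<epsilon> * t))" for t
    by (simp add: F_def exp_s norm_mult)
  have "(LBINT t=0..\<infinity>. f t) = 0 - 0"
  proof (rule interval_integral_FTC_integrable)
    fix t :: real assume "0 < ereal t"
    then have t: "0 < t" by simp
    have "(F has_vector_derivative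
        of_real (t powr (p + 1)) * (- ?s * exp (- (?s * of_real t))) + of_real ((p + 1) * t powr p) * exp (- (?s * of_real t))) (at t)"
      unfolding F_def
    proof (rule has_vector_derivative_mult)
      have "((\<lambda>t. t powr (p + 1)) has_real_derivative (p + 1) * t powr p) (at t)"
        using t by (auto intro!: derivative_eq_intros)
      then show "((\<lambda>t. complex_of_real (t powr (p + 1))) has_vector_derivative of_real ((p + 1) * t powr p)) (at t)"
        by (intro has_vector_derivative_of_real) (simp add: has_real_derivative_iff_has_vector_derivative)
      have "((\<lambda>z. exp (- (?s * z))) has_field_derivative - ?s * exp (- (?s * of_real t))) (at (of_real t))"
        by (auto intro!: derivative_eq_intros)
      then show "((\<lambda>t. exp (- (?s * of_real t))) has_vector_derivative - ?s * exp (- (?s * of_real t))) (at t)"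
        by (rule has_vector_derivative_real_field)
    qed
    also have "of_real (t powr (p + 1)) * (- ?s * exp (- (?s * of_real t))) + of_real ((p + 1) * t powr p) * exp (- (?s * of_real t)) = f t"
      using t by (simp add: f_eq algebra_simps)
    finally show "(F has_vector_derivative f t) (at t)" .
    have "isCont (\<lambda>t. (of_real ((p + 1) * t powr p) - ?s * of_real (t powr (p + 1))) * exp (- (?s * of_real t))) t"
      using t by (intro continuous_intros) auto
    moreover have "\<forall>\<^sub>F u in nhds t. f u = (of_real ((p + 1) * u powr p) - ?s * of_real (u powr (p + 1))) * exp (- (?s * of_real u))"
      by (rule eventually_mono[OF eventually_nhds_in_open[of "{0<..}" t]]) (use t in \<open>simp_all add: f_eq\<close>)
    ultimately show "isCont f t" by (simp add: isCont_cong)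
  next
    show "set_integrable lborel (einterval 0 \<infinity>) f"
      unfolding set_integrable_def using f_int by (intro integrable_mult_indicator) auto
    have "((\<lambda>t. t powr (p + 1) * exp (- (\<epsilon> * t))) \<longlongrightarrow> 0) (at_right 0)"
      using assms by real_asymp
    then have "(F \<longlongrightarrow> 0) (at_right 0)"
      by (subst tendsto_norm_zero_iff[symmetric]) (simp add: norm_F)
    then show "((F \<circ> real_of_ereal) \<longlongrightarrow> 0) (at_right 0)"
      by (simp add: ereal_tendsto_simps zero_ereal_def)
    have "((\<lambda>t. t powr (p + 1) * exp (- (\<epsilon> * t))) \<longlongrightarrow> 0) at_top"
      using assms by real_asymp
    then have "(F \<longlongrightarrow> 0) at_top"
      by (subst tendsto_norm_zero_iff[symmetric]) (simp add: norm_F)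
    then show "((F \<circ> real_of_ereal) \<longlongrightarrow> 0) (at_left \<infinity>)"
      by (simp add: ereal_tendsto_simps)
  qed auto
  moreover have "(LBINT t=0..\<infinity>. f t) = (LINT t|lborel. f t)"
    unfolding interval_lebesgue_integral_def set_lebesgue_integral_def
    by (auto intro!: Bochner_Integration.integral_cong simp: einterval_def indicator_def f_zero)
  ultimately have "(LINT t|lborel. f t) = 0" by simp
  then show ?thesis
    unfolding f_def damped_gamma_def using assms
    by (subst (asm) Bochner_Integration.integral_diff)
       (auto intro!: integrable_mult_right integrable_damped_gamma simp del: of_real_mult of_real_add)
qed

text \<open>
  Differentiation under the integral sign. The second order Taylor bound for the exponential
  controls the remainder by \<open>h\<^sup>2\<close> times a convergent gamma integral of order \<open>p + 2\<close>.
\<close>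

lemma damped_gamma_has_vector_derivative:
  assumes "0 < p" "0 < \<epsilon>"
  shows "(damped_gamma \<epsilon> p has_vector_derivative \<i> * damped_gamma \<epsilon> (p + 1) \<omega>) (at \<omega>)"
proof -
  define c where "c t = complex_of_real (pos_part_powr t p * exp (- (\<epsilon> * t)))" for t
  define K where "K = (LINT t|lborel. pos_part_powr t (p + 2) * exp (- (\<epsilon> * t)))"
  have powr_Suc: "pos_part_powr t (q + 1) = t * pos_part_powr t q" if "0 < q" for t q
    using that by (auto simp: pos_part_powr_def powr_add)
  have int: "integrable lborel (\<lambda>t. c t * iexp (\<omega> * t))" for \<omega>
    unfolding c_def by (rule integrable_damped_gamma[OF assms])
  have int1: "integrable lborel (\<lambda>t. of_real t * c t * iexp (\<omega> * t))"
    using integrable_damped_gamma[of "p + 1" \<epsilon> \<omega>] assms by (simp add: c_def powr_Suc mult_ac)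
  have eq: "damped_gamma \<epsilon> p \<omega> = (LINT t|lborel. c t * iexp (\<omega> * t))" for \<omega>
    by (simp only: damped_gamma_def c_def)
  have eq1: "damped_gamma \<epsilon> (p + 1) \<omega> = (LINT t|lborel. of_real t * c t * iexp (\<omega> * t))"
    unfolding damped_gamma_def using assms
    by (intro Bochner_Integration.integral_cong) (simp_all add: c_def powr_Suc mult_ac)
  have K_int: "integrable lborel (\<lambda>t. pos_part_powr t (p + 2) * exp (- (\<epsilon> * t)))"
    using assms by (intro integrable_damped_pos_part_powr) auto
  have remainder: "norm (damped_gamma \<epsilon> p (\<omega> + h) - damped_gamma \<epsilon> p \<omega> - h *\<^sub>R (\<i> * damped_gamma \<epsilon> (p + 1) \<omega>)) \<le> h\<^sup>2 * K" for h
  proof -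
    have "damped_gamma \<epsilon> p (\<omega> + h) - damped_gamma \<epsilon> p \<omega> - h *\<^sub>R (\<i> * damped_gamma \<epsilon> (p + 1) \<omega>)
        = damped_gamma \<epsilon> p (\<omega> + h) - damped_gamma \<epsilon> p \<omega> - of_real h * \<i> * damped_gamma \<epsilon> (p + 1) \<omega>"
      by (simp add: scaleR_conv_of_real)
    also have "\<dots> = (LINT t|lborel. c t * iexp ((\<omega> + h) * t) - c t * iexp (\<omega> * t) - of_real h * \<i> * (of_real t * c t * iexp (\<omega> * t)))"
      unfolding eq eq1
      by (subst Bochner_Integration.integral_diff[OF Bochner_Integration.integrable_diff[OF int int] integrable_mult_right[OF int1]],
          subst Bochner_Integration.integral_diff[OF int int], subst integral_mult_right_zero, rule refl)
    finally have "norm (damped_gamma \<epsilon> p (\<omega> + h) - damped_gamma \<epsilon> p \<omega> - h *\<^sub>R (\<i> * damped_gamma \<epsilon> (p + 1) \<omega>))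
        = norm (LINT t|lborel. c t * iexp ((\<omega> + h) * t) - c t * iexp (\<omega> * t) - of_real h * \<i> * (of_real t * c t * iexp (\<omega> * t)))"
      by (rule arg_cong)
    also have "\<dots> \<le> (LINT t|lborel. h\<^sup>2 * (pos_part_powr t (p + 2) * exp (- (\<epsilon> * t))))"
    proof (rule order_trans[OF integral_norm_bound], rule integral_mono)
      fix t
      have "c t * iexp ((\<omega> + h) * t) - c t * iexp (\<omega> * t) - of_real h * \<i> * (of_real t * c t * iexp (\<omega> * t))
          = c t * iexp (\<omega> * t) * (iexp (h * t) - (\<Sum>k\<le>1. (\<i> * of_real (h * t)) ^ k / fact k))"
        by (simp add: algebra_simps exp_add)
      also have "norm \<dots> \<le> norm (c t * iexp (\<omega> * t)) * (\<bar>h * t\<bar> ^ Suc 1 / fact (Suc 1))"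
        unfolding norm_mult[of "c t * iexp (\<omega> * t)"] by (intro mult_left_mono iexp_approx1) auto
      also have "norm (c t * iexp (\<omega> * t)) = pos_part_powr t p * exp (- (\<epsilon> * t))"
        by (simp add: c_def norm_mult)
      also have "\<bar>h * t\<bar> ^ Suc 1 / fact (Suc 1) \<le> h\<^sup>2 * t\<^sup>2"
        unfolding Suc_1 power2_abs power_mult_distrib by simp
      also have "pos_part_powr t p * exp (- (\<epsilon> * t)) * (h\<^sup>2 * t\<^sup>2) = h\<^sup>2 * (pos_part_powr t (p + 2) * exp (- (\<epsilon> * t)))"
        using powr_Suc[of "p" t] powr_Suc[of "p + 1" t] assms by (simp add: power2_eq_square mult_ac add.assoc)
      finally show "norm (c t * iexp ((\<omega> + h) * t) - c t * iexp (\<omega> * t) - of_real h * \<i> * (of_real t * c t * iexp (\<omega> * t)))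
          \<le> h\<^sup>2 * (pos_part_powr t (p + 2) * exp (- (\<epsilon> * t)))"
        by (simp add: mult_left_mono)
    qed (intro integrable_norm Bochner_Integration.integrable_diff integrable_mult_right int int1 K_int)+
    also have "\<dots> = h\<^sup>2 * K" unfolding K_def by (rule integral_mult_right_zero)
    finally show ?thesis .
  qed
  show ?thesis
    unfolding has_vector_derivative_def has_derivative_at
  proof (intro conjI bounded_linear_scaleR_left)
    show "(\<lambda>h. norm (damped_gamma \<epsilon> p (\<omega> + h) - damped_gamma \<epsilon> p \<omega> - h *\<^sub>R (\<i> * damped_gamma \<epsilon> (p + 1) \<omega>)) / norm h) \<midarrow>0\<rightarrow> 0"
    proof (rule tendsto_sandwich[OF _ _ tendsto_const])
      show "(\<lambda>h. \<bar>h\<bar> * K) \<midarrow>0\<rightarrow> 0" by (auto intro!: tendsto_eq_intros)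
      show "\<forall>\<^sub>F h in at 0. norm (damped_gamma \<epsilon> p (\<omega> + h) - damped_gamma \<epsilon> p \<omega> - h *\<^sub>R (\<i> * damped_gamma \<epsilon> (p + 1) \<omega>)) / norm h \<le> \<bar>h\<bar> * K"
      proof (rule eventually_at_topological[THEN iffD2], intro exI[of _ UNIV] conjI ballI impI open_UNIV UNIV_I)
        fix h :: real assume "h \<noteq> 0"
        moreover have "h\<^sup>2 * K = \<bar>h\<bar> * K * \<bar>h\<bar>"
          by (metis abs_mult_self_eq mult.assoc mult.commute power2_eq_square)
        ultimately show "norm (damped_gamma \<epsilon> p (\<omega> + h) - damped_gamma \<epsilon> p \<omega> - h *\<^sub>R (\<i> * damped_gamma \<epsilon> (p + 1) \<omega>)) / norm h \<le> \<bar>h\<bar> * K"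
          using remainder[of h] by (metis pos_divide_le_eq real_norm_def zero_less_abs_iff)
      qed
    qed auto
  qed
qed

text \<open>
  Multiplied by \<open>s powr (p + 1)\<close>, where \<open>s = \<epsilon> - \<i> \<omega>\<close>, the integral has derivative zero in \<open>\<omega>\<close>:
  the derivative raises the order by one, and the recurrence brings it down again. The constant is
  found at \<open>\<omega> = 0\<close>, where the integral is a real gamma integral. This differential equation takes the
  place of a rotation of the contour.
\<close>

lemma damped_gamma_eq:
  assumes "0 < p" "0 < \<epsilon>"
  shows "damped_gamma \<epsilon> p \<omega> = of_real (Gamma (p + 1)) * Complex \<epsilon> (- \<omega>) powr (- of_real (p + 1))"
proof -
  define s where "s \<omega> = of_real \<epsilon> - \<i> * complex_of_real \<omega>" for \<omega>
  have s: "s \<omega> = Complex \<epsilon> (- \<omega>)" for \<omega> by (simp add: s_def complex_eq_iff)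
  have s_pos: "s \<omega> \<notin> \<real>\<^sub>\<le>\<^sub>0" "s \<omega> \<noteq> 0" for \<omega>
    using assms by (auto simp: s complex_nonpos_Reals_iff complex_eq_iff)
  define H where "H \<omega> = damped_gamma \<epsilon> p \<omega> * s \<omega> powr (of_real (p + 1))" for \<omega>
  have "(H has_vector_derivative 0) (at \<omega>)" for \<omega>
  proof -
    have "((\<lambda>z. (of_real \<epsilon> - \<i> * z) powr (of_real (p + 1))) has_field_derivative
        of_real (p + 1) * s \<omega> powr (of_real p) * (- \<i>)) (at (of_real \<omega>))"
      using s_pos(1)[of \<omega>] unfolding s_def
      by (auto intro!: derivative_eq_intros has_field_derivative_powr)
    then have "((\<lambda>\<omega>. s \<omega> powr (of_real (p + 1))) has_vector_derivative
        of_real (p + 1) * s \<omega> powr (of_real p) * (- \<i>)) (at \<omega>)"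
      unfolding s_def by (rule has_vector_derivative_real_field)
    from has_vector_derivative_mult[OF damped_gamma_has_vector_derivative[OF assms] this]
    have "(H has_vector_derivative
        damped_gamma \<epsilon> p \<omega> * (of_real (p + 1) * s \<omega> powr (of_real p) * (- \<i>))
        + \<i> * damped_gamma \<epsilon> (p + 1) \<omega> * s \<omega> powr (of_real (p + 1))) (at \<omega>)"
      unfolding H_def .
    also have "damped_gamma \<epsilon> p \<omega> * (of_real (p + 1) * s \<omega> powr (of_real p) * (- \<i>))
        + \<i> * damped_gamma \<epsilon> (p + 1) \<omega> * s \<omega> powr (of_real (p + 1))
        = \<i> * s \<omega> powr (of_real p) * (s \<omega> * damped_gamma \<epsilon> (p + 1) \<omega> - of_real (p + 1) * damped_gamma \<epsilon> p \<omega>)"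
      using s_pos(2)[of \<omega>] by (simp add: powr_add algebra_simps)
    also have "\<dots> = 0" using damped_gamma_recurrence[OF assms, of \<omega>] by (simp add: s)
    finally show ?thesis .
  qed
  then have "H \<omega> = H 0"
    using has_vector_derivative_zero_constant[of UNIV H] by (metis UNIV_I convex_UNIV)
  also have "H 0 = of_real (Gamma (p + 1) * \<epsilon> powr (- (p + 1))) * of_real \<epsilon> powr (of_real (p + 1))"
    using integral_damped_pos_part_powr[OF assms]
    by (simp add: H_def s_def damped_gamma_def del: of_real_mult)
  also have "\<dots> = of_real (Gamma (p + 1) * (\<epsilon> powr (- (p + 1)) * \<epsilon> powr (p + 1)))"
    using assms by (subst powr_of_real) auto
  also have "\<epsilon> powr (- (p + 1)) * \<epsilon> powr (p + 1) = 1"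
    using assms by (simp flip: powr_add)
  finally have "damped_gamma \<epsilon> p \<omega> * s \<omega> powr (of_real (p + 1)) = of_real (Gamma (p + 1))"
    by (simp add: H_def)
  moreover have "s \<omega> powr (of_real (p + 1)) \<noteq> 0" using s_pos(2) by simp
  ultimately show ?thesis
    unfolding s[symmetric] powr_minus by (metis divide_inverse nonzero_eq_divide_eq)
qed

section \<open>Decay of Schwartz functions\<close>

lemma schwartz_continuous: "schwartz \<phi> \<Longrightarrow> continuous_on UNIV \<phi>"
proof -
  assume "schwartz \<phi>"
  then have "vderiv 0 \<phi> differentiable (at x)" for x
    unfolding schwartz_def by blast
  then show ?thesis
    by (auto simp: vderiv_def intro!: continuous_at_imp_continuous_on differentiable_imp_continuous_within)
qed

lemma schwartz_decay:
  assumes "schwartz \<phi>"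
  shows "\<exists>C\<ge>0. \<forall>y. norm (\<phi> y) \<le> C / (1 + \<bar>y\<bar>) ^ M"
proof -
  have "bounded (range (\<lambda>x. x ^ m *\<^sub>R \<phi> x))" for m
    using assms unfolding schwartz_def vderiv_def by (metis funpow_0)
  then have "\<exists>B. \<forall>x. \<bar>x\<bar> ^ m * norm (\<phi> x) \<le> B" for m
    by (fastforce simp: bounded_iff norm_mult power_abs)
  then obtain B where B: "\<And>m x. \<bar>x\<bar> ^ m * norm (\<phi> x) \<le> B m" by metis
  have B0: "norm (\<phi> x) \<le> B 0" for x using B[of x 0] by simp
  show ?thesis
  proof (intro exI[of _ "2 ^ M * (B 0 + B M)"] conjI allI)
    have "0 \<le> B m" for m
      by (rule order_trans[OF _ B[of 0 m]]) simp
    then show "0 \<le> 2 ^ M * (B 0 + B M)" by simp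
    fix y :: real
    have "(1 + \<bar>y\<bar>) ^ M \<le> 2 ^ M * (1 + \<bar>y\<bar> ^ M)"
    proof (cases "\<bar>y\<bar> \<le> 1")
      case True
      then have "(1 + \<bar>y\<bar>) ^ M \<le> 2 ^ M" by (intro power_mono) auto
      also have "\<dots> \<le> 2 ^ M * (1 + \<bar>y\<bar> ^ M)" by simp
      finally show ?thesis .
    next
      case False
      then have "(1 + \<bar>y\<bar>) ^ M \<le> (2 * \<bar>y\<bar>) ^ M" by (intro power_mono) auto
      also have "\<dots> \<le> 2 ^ M * (1 + \<bar>y\<bar> ^ M)" by (simp add: power_mult_distrib)
      finally show ?thesis .
    qed
    then have "norm (\<phi> y) * (1 + \<bar>y\<bar>) ^ M \<le> norm (\<phi> y) * (2 ^ M * (1 + \<bar>y\<bar> ^ M))"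
      by (intro mult_left_mono) auto
    also have "\<dots> = 2 ^ M * (norm (\<phi> y) + \<bar>y\<bar> ^ M * norm (\<phi> y))"
      by (simp add: algebra_simps)
    also have "\<dots> \<le> 2 ^ M * (B 0 + B M)"
      by (intro mult_left_mono add_mono B0 B) auto
    finally show "norm (\<phi> y) \<le> 2 ^ M * (B 0 + B M) / (1 + \<bar>y\<bar>) ^ M"
      by (simp add: pos_le_divide_eq)
  qed
qed

lemma integrable_inverse_power_weight:
  assumes "2 \<le> M"
  shows "integrable lborel (\<lambda>x. 1 / (1 + \<bar>x - b\<bar>) ^ M :: real)"
proof -
  have *: "integrable lborel (\<lambda>x::real. inverse (1 + x\<^sup>2))"
    using integrable_inverse_1_plus_square by (simp add: set_integrable_def)
  have "integrable lborel (\<lambda>x. 1 / (1 + \<bar>x\<bar>) ^ M :: real)"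
  proof (rule Bochner_Integration.integrable_bound[OF *])
    show "AE x::real in lborel. norm (1 / (1 + \<bar>x\<bar>) ^ M) \<le> norm (inverse (1 + x\<^sup>2))"
    proof (rule AE_I2)
      fix x :: real
      have "1 + x\<^sup>2 \<le> (1 + \<bar>x\<bar>)\<^sup>2" by (simp add: power2_eq_square algebra_simps)
      also have "\<dots> \<le> (1 + \<bar>x\<bar>) ^ M" using assms by (intro power_increasing) auto
      finally have "1 / (1 + \<bar>x\<bar>) ^ M \<le> 1 / (1 + x\<^sup>2)"
        by (intro divide_left_mono) (auto simp: add_pos_nonneg intro!: mult_pos_pos)
      then show "norm (1 / (1 + \<bar>x\<bar>) ^ M) \<le> norm (inverse (1 + x\<^sup>2))"
        by (simp add: divide_inverse)
    qed
  qed simp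
  from lborel_integrable_real_affine[OF this, of 1 "- b"] show ?thesis by simp
qed

lemma schwartz_integrable:
  assumes "schwartz \<kappa>"
  shows "integrable lborel \<kappa>"
proof -
  obtain C where C: "0 \<le> C" "\<And>y. norm (\<kappa> y) \<le> C / (1 + \<bar>y\<bar>) ^ 2"
    using schwartz_decay[OF assms, of 2] by auto
  have [measurable]: "\<kappa> \<in> borel_measurable borel"
    using schwartz_continuous[OF assms] by (rule borel_measurable_continuous_onI)
  show ?thesis
  proof (rule Bochner_Integration.integrable_bound)
    show "integrable lborel (\<lambda>y. C * (1 / (1 + \<bar>y - 0\<bar>) ^ 2 :: real))"
      by (intro integrable_mult_right integrable_inverse_power_weight) auto
  qed (use C in \<open>auto intro!: AE_I2\<close>)
qed

lemma integrable_schwartz_powr: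
  assumes "schwartz \<kappa>" "0 < \<gamma>" "\<gamma> \<le> 1"
  shows "integrable lborel (\<lambda>y. \<bar>y\<bar> powr \<gamma> * norm (\<kappa> y))"
proof -
  obtain C where C: "0 \<le> C" "\<And>y. norm (\<kappa> y) \<le> C / (1 + \<bar>y\<bar>) ^ 3"
    using schwartz_decay[OF assms(1), of 3] by auto
  have [measurable]: "\<kappa> \<in> borel_measurable borel"
    using schwartz_continuous[OF assms(1)] by (rule borel_measurable_continuous_onI)
  show ?thesis
  proof (rule Bochner_Integration.integrable_bound)
    show "integrable lborel (\<lambda>y. C * (1 / (1 + \<bar>y - 0\<bar>) ^ 2 :: real))"
      by (intro integrable_mult_right integrable_inverse_power_weight) auto
    show "AE y in lborel. norm (\<bar>y\<bar> powr \<gamma> * norm (\<kappa> y)) \<le> norm (C * (1 / (1 + \<bar>y - 0\<bar>) ^ 2 :: real))"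
    proof (rule AE_I2)
      fix y :: real
      have "\<bar>y\<bar> powr \<gamma> \<le> (1 + \<bar>y\<bar>) powr \<gamma>" using assms by (intro powr_mono2) auto
      also have "\<dots> \<le> (1 + \<bar>y\<bar>) powr 1" using assms by (intro powr_mono) auto
      finally have "\<bar>y\<bar> powr \<gamma> \<le> 1 + \<bar>y\<bar>" by simp
      then have "\<bar>y\<bar> powr \<gamma> * norm (\<kappa> y) \<le> (1 + \<bar>y\<bar>) * (C / (1 + \<bar>y\<bar>) ^ 3)"
        by (intro mult_mono C) auto
      also have "\<dots> = C / (1 + \<bar>y\<bar>) ^ 2"
        by (simp add: power3_eq_cube power2_eq_square divide_simps add_nonneg_eq_0_iff)
      finally show "norm (\<bar>y\<bar> powr \<gamma> * norm (\<kappa> y)) \<le> norm (C * (1 / (1 + \<bar>y - 0\<bar>) ^ 2 :: real))"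
        using C(1) by (simp add: abs_mult)
    qed
  qed simp
qed

lemma locally_integrable_measurable:
  assumes "locally_integrable f"
  shows "f \<in> borel_measurable lebesgue"
proof (rule borel_measurable_LIMSEQ_real)
  show "(\<lambda>n. indicator {- real n..real n} x * f x) \<longlonglongrightarrow> f x" for x
  proof (rule tendsto_eventually)
    obtain N :: nat where "\<bar>x\<bar> \<le> N" using real_arch_simple by blast
    then have "x \<in> {- real n..real n}" if "N \<le> n" for n using that by auto
    then show "\<forall>\<^sub>F n in sequentially. indicator {- real n..real n} x * f x = f x"
      by (auto simp: eventually_sequentially intro!: exI[of _ N])
  qed
  show "(\<lambda>x. indicator {- real n..real n} x * f x) \<in> borel_measurable lebesgue" for n
    using assms compact_Icc[of "- real n" "real n"]
    unfolding locally_integrable_def set_integrable_def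
    by (metis (no_types, lifting) borel_measurable_integrable real_scaleR_def ext)
qed

text \<open>
  The exponent \<open>N + 3\<close> makes the weight integrable against \<open>\<bar>x\<bar> ^ N\<close> and against the homogeneous
  factor of order at most one that is subtracted from \<open>f\<close> later.
\<close>

lemma integrable_polynomial_growth_weight:
  assumes f: "locally_integrable f" and O: "f \<in> O[at_infinity](\<lambda>x. \<bar>x\<bar> ^ N)"
  shows "integrable lebesgue (\<lambda>x. f x * (1 / (1 + \<bar>x - b\<bar>) ^ (N + 3)))"
proof -
  from O obtain c R where R: "\<And>x. R \<le> norm x \<Longrightarrow> \<bar>f x\<bar> \<le> c * \<bar>x\<bar> ^ N" and c: "0 < c"
    by (elim landau_o.bigE) (auto simp: eventually_at_infinity)
  define D where "D = c * (1 + \<bar>b\<bar>) ^ N"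
  have [measurable]: "f \<in> borel_measurable lebesgue" by (rule locally_integrable_measurable[OF f])
  have meas_w: "(\<lambda>x. 1 / (1 + \<bar>x - b\<bar>) ^ (N + 3)) \<in> borel_measurable lebesgue"
    by (rule measurable_completion) measurable
  have "f absolutely_integrable_on {-R..R}"
    using f compact_Icc[of "-R" "R"] unfolding locally_integrable_def by blast
  then have 1: "integrable lebesgue (\<lambda>x. \<bar>indicator {-R..R} x * f x\<bar>)"
    unfolding set_integrable_def by (auto intro: integrable_abs)
  have "integrable lebesgue (\<lambda>x. 1 / (1 + \<bar>x - b\<bar>) ^ 3 :: real)"
    by (subst integrable_completion) (auto intro!: integrable_inverse_power_weight)
  then have 2: "integrable lebesgue (\<lambda>x. D * (1 / (1 + \<bar>x - b\<bar>) ^ 3))"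
    by (rule integrable_mult_right)
  show ?thesis
  proof (rule Bochner_Integration.integrable_bound[OF Bochner_Integration.integrable_add[OF 1 2]])
    show "AE x in lebesgue. norm (f x * (1 / (1 + \<bar>x - b\<bar>) ^ (N + 3))) \<le>
       norm (\<bar>indicator {-R..R} x * f x\<bar> + D * (1 / (1 + \<bar>x - b\<bar>) ^ 3))"
    proof (rule AE_I2)
      fix x :: real
      have D: "0 \<le> D * (1 / (1 + \<bar>x - b\<bar>) ^ 3)" using c by (simp add: D_def)
      show "norm (f x * (1 / (1 + \<bar>x - b\<bar>) ^ (N + 3))) \<le>
         norm (\<bar>indicator {-R..R} x * f x\<bar> + D * (1 / (1 + \<bar>x - b\<bar>) ^ 3))"
      proof (cases "x \<in> {-R..R}")
        case True
        have "1 \<le> (1 + \<bar>x - b\<bar>) ^ (N + 3)" by (rule one_le_power) simp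
        then have "\<bar>f x\<bar> * (1 / (1 + \<bar>x - b\<bar>) ^ (N + 3)) \<le> \<bar>f x\<bar> * 1"
          by (intro mult_left_mono) (auto simp: divide_simps)
        then show ?thesis using True D by (simp add: abs_mult)
      next
        case False
        then have "R \<le> norm x" by auto
        note R[OF this]
        also have "\<bar>x\<bar> ^ N \<le> ((1 + \<bar>b\<bar>) * (1 + \<bar>x - b\<bar>)) ^ N"
        proof (rule power_mono)
          have "\<bar>x\<bar> \<le> 1 + \<bar>b\<bar> + \<bar>x - b\<bar>" by simp
          also have "\<dots> \<le> 1 + \<bar>b\<bar> + \<bar>x - b\<bar> + \<bar>b\<bar> * \<bar>x - b\<bar>" by simp
          finally show "\<bar>x\<bar> \<le> (1 + \<bar>b\<bar>) * (1 + \<bar>x - b\<bar>)" by (simp add: algebra_simps)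
        qed simp
        also have "c * \<dots> = D * (1 + \<bar>x - b\<bar>) ^ N" by (simp add: D_def power_mult_distrib)
        finally have "\<bar>f x\<bar> \<le> D * (1 + \<bar>x - b\<bar>) ^ N" using c by simp
        then have "\<bar>f x\<bar> * (1 / (1 + \<bar>x - b\<bar>) ^ (N + 3)) \<le> D * (1 + \<bar>x - b\<bar>) ^ N * (1 / (1 + \<bar>x - b\<bar>) ^ (N + 3))"
          by (intro mult_right_mono) auto
        also have "\<dots> = D * (1 / (1 + \<bar>x - b\<bar>) ^ 3)"
          by (simp add: power_add divide_simps add_nonneg_eq_0_iff)
        finally have "\<bar>f x\<bar> * (1 / (1 + \<bar>x - b\<bar>) ^ (N + 3)) \<le> D * (1 / (1 + \<bar>x - b\<bar>) ^ 3)" .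
        moreover have "0 \<le> D" using c by (simp add: D_def)
        ultimately show ?thesis using False by (simp add: abs_mult)
      qed
    qed
  qed (intro borel_measurable_times meas_w, measurable)
qed

section \<open>Pairing at small scales\<close>

text \<open>
  If \<open>f\<close> behaves at \<open>b\<close> like a function \<open>h\<close> homogeneous of degree \<open>\<gamma>\<close>, the pairings with the
  wavelets at scale \<open>a\<close> are those of \<open>h\<close> to leading order, and by homogeneity these scale exactly
  like \<open>a powr (\<gamma> + 1 / 2)\<close>. The remainder \<open>r x = f x - h (x - b)\<close> is treated in two regions. Near
  \<open>b\<close> it is at most \<open>\<eta> * \<bar>x - b\<bar> powr \<gamma>\<close> with \<open>\<eta>\<close> as small as desired, which contributes \<open>\<eta>\<close> times the
  leading order. Away from \<open>b\<close> the wavelet is smaller than any power of \<open>a\<close>, uniformly against an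
  integrable weight that \<open>f\<close> tolerates by its polynomial growth. The function \<open>f\<close> itself, which
  is merely Lebesgue measurable, is never rescaled.
\<close>

lemma pairing_asymptotics:
  fixes f g h :: "real \<Rightarrow> real" and \<kappa> :: "real \<Rightarrow> complex"
  assumes \<kappa>: "schwartz \<kappa>" and \<gamma>: "0 < \<gamma>" "\<gamma> \<le> 1"
    and f: "locally_integrable f" "polynomial_growth f"
    and h [measurable]: "h \<in> borel_measurable borel"
    and h_le: "\<And>y. \<bar>h y\<bar> \<le> \<bar>y\<bar> powr \<gamma>"
    and h_hom: "\<And>a y. 0 < a \<Longrightarrow> h (a * y) = a powr \<gamma> * h y"
    and g: "(g \<longlongrightarrow> 0) (at b)"
    and fg: "\<And>x. f x = h (x - b) * (1 + g x)"
  shows "((\<lambda>a. a powr (- \<gamma> - 1 / 2) *\<^sub>R regular_distribution (\<lambda>x. of_real (f x)) (wavelet_dilate \<kappa> a b))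
           \<longlongrightarrow> (LINT y|lborel. of_real (h y) * \<kappa> y)) (at_right 0)"
proof -
  define L where "L = (LINT y|lborel. of_real (h y) * \<kappa> y)"
  have [measurable]: "\<kappa> \<in> borel_measurable borel"
    using schwartz_continuous[OF \<kappa>] by (rule borel_measurable_continuous_onI)
  have [measurable]: "f \<in> borel_measurable lebesgue" by (rule locally_integrable_measurable[OF f(1)])
  obtain N where N: "f \<in> O[at_infinity](\<lambda>x. \<bar>x\<bar> ^ N)" using f(2) by (auto simp: polynomial_growth_def)
  define w where "w x = 1 / (1 + \<bar>x - b\<bar>) ^ (N + 3)" for x :: real
  have w_pos: "0 < w x" for x by (simp add: w_def add_pos_nonneg)
  define r where "r x = f x - h (x - b)" for x
  obtain C where C: "0 \<le> C" "\<And>y. norm (\<kappa> y) \<le> C / (1 + \<bar>y\<bar>) ^ (N + 3)"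
    using schwartz_decay[OF \<kappa>, of "N + 3"] by auto
  have h\<kappa>: "integrable lborel (\<lambda>y. of_real (h y) * \<kappa> y)"
    by (rule Bochner_Integration.integrable_bound[OF integrable_schwartz_powr[OF \<kappa> \<gamma>]])
       (auto simp: norm_mult intro!: mult_right_mono h_le)
  have A_int: "integrable lborel (\<lambda>y. \<bar>y\<bar> powr \<gamma> * norm (\<kappa> y))"
    by (rule integrable_schwartz_powr[OF \<kappa> \<gamma>])
  define A where "A = (LINT y|lborel. \<bar>y\<bar> powr \<gamma> * norm (\<kappa> y))"
  have "0 \<le> A" unfolding A_def by simp
  have hw: "integrable lborel (\<lambda>x. h (x - b) * w x)"
  proof (rule Bochner_Integration.integrable_bound)
    show "integrable lborel (\<lambda>x. 1 / (1 + \<bar>x - b\<bar>) ^ 2 :: real)"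
      by (rule integrable_inverse_power_weight) simp
    show "AE x in lborel. norm (h (x - b) * w x) \<le> norm (1 / (1 + \<bar>x - b\<bar>) ^ 2 :: real)"
    proof (rule AE_I2)
      fix x
      have "\<bar>h (x - b)\<bar> \<le> \<bar>x - b\<bar> powr \<gamma>" by (rule h_le)
      also have "\<dots> \<le> (1 + \<bar>x - b\<bar>) powr \<gamma>" using \<gamma> by (intro powr_mono2) auto
      also have "\<dots> \<le> (1 + \<bar>x - b\<bar>) powr 1" using \<gamma> by (intro powr_mono) auto
      finally have "\<bar>h (x - b)\<bar> \<le> (1 + \<bar>x - b\<bar>) ^ 1" by simp
      also have "\<dots> \<le> (1 + \<bar>x - b\<bar>) ^ (N + 1)" by (rule power_increasing) auto
      finally have "\<bar>h (x - b)\<bar> * w x \<le> (1 + \<bar>x - b\<bar>) ^ (N + 1) * w x"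
        using w_pos[of x] by (intro mult_right_mono) auto
      also have "\<dots> = (1 + \<bar>x - b\<bar>) ^ (N + 1) / (1 + \<bar>x - b\<bar>) ^ ((N + 1) + 2)"
        by (simp add: w_def numeral_eq_Suc)
      also have "\<dots> = 1 / (1 + \<bar>x - b\<bar>) ^ 2"
        unfolding power_add[of _ "N + 1" 2] by (simp add: add_nonneg_eq_0_iff)
      finally show "norm (h (x - b) * w x) \<le> norm (1 / (1 + \<bar>x - b\<bar>) ^ 2 :: real)"
        using w_pos[of x] by (simp add: abs_mult)
    qed
  qed (simp add: w_def)
  have rw: "integrable lebesgue (\<lambda>x. \<bar>r x\<bar> * w x)"
  proof -
    have "integrable lebesgue (\<lambda>x. h (x - b) * w x)"
      using hw by (subst integrable_completion) (auto simp: w_def)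
    from Bochner_Integration.integrable_diff[OF
        integrable_polynomial_growth_weight[OF f(1) N, of b, folded w_def] this]
    have "integrable lebesgue (\<lambda>x. norm (r x * w x))"
      by (intro integrable_norm) (simp add: r_def algebra_simps)
    then show ?thesis using w_pos by (simp add: abs_mult less_imp_le)
  qed
  define B where "B = (LINT x|lebesgue. \<bar>r x\<bar> * w x)"
  define E where "E a = (LINT x|lebesgue. of_real (r x) * \<kappa> ((x - b) / a))" for a
  have meas_r [measurable]: "r \<in> borel_measurable lebesgue"
  proof -
    have [measurable]: "(\<lambda>x. h (x - b)) \<in> borel_measurable lebesgue"
      by (rule measurable_completion) measurable
    show ?thesis unfolding r_def by measurable
  qed
  have meas_cr: "(\<lambda>x. complex_of_real (r x)) \<in> borel_measurable lebesgue" by measurable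
  have meas_\<kappa> [measurable]: "(\<lambda>x. \<kappa> ((x - b) / a)) \<in> borel_measurable lebesgue" for a
    by (rule measurable_completion) measurable
  have far: "norm (\<kappa> ((x - b) / a)) \<le> C * ((1 + \<delta>) / \<delta>) ^ (N + 3) * a ^ (N + 3) * w x"
    if "0 < a" "0 < \<delta>" "\<delta> \<le> \<bar>x - b\<bar>" for a \<delta> x
  proof -
    have "\<delta> * (1 + \<bar>x - b\<bar>) \<le> (1 + \<delta>) * \<bar>x - b\<bar>" using that by (simp add: algebra_simps)
    also have "\<dots> \<le> (1 + \<delta>) * (a + \<bar>x - b\<bar>)" using that by (intro mult_left_mono) auto
    finally have "\<delta> * (1 + \<bar>x - b\<bar>) / ((1 + \<delta>) * a) \<le> (1 + \<delta>) * (a + \<bar>x - b\<bar>) / ((1 + \<delta>) * a)"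
      using that by (intro divide_right_mono) auto
    also have "\<dots> = (a + \<bar>x - b\<bar>) / a" using that by simp
    also have "\<dots> = 1 + \<bar>(x - b) / a\<bar>" using that by (simp add: add_divide_distrib)
    finally have le: "\<delta> / ((1 + \<delta>) * a) * (1 + \<bar>x - b\<bar>) \<le> 1 + \<bar>(x - b) / a\<bar>" by simp
    have pos: "0 < \<delta> / ((1 + \<delta>) * a) * (1 + \<bar>x - b\<bar>)" using that by (simp add: add_pos_nonneg)
    have "norm (\<kappa> ((x - b) / a)) \<le> C / (1 + \<bar>(x - b) / a\<bar>) ^ (N + 3)" by (rule C)
    also have "\<dots> \<le> C / (\<delta> / ((1 + \<delta>) * a) * (1 + \<bar>x - b\<bar>)) ^ (N + 3)"
      using le pos C(1) by (intro divide_left_mono power_mono) auto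
    also have "\<dots> = C * ((1 + \<delta>) / \<delta>) ^ (N + 3) * a ^ (N + 3) * w x"
      by (simp add: w_def power_mult_distrib power_divide)
    finally show ?thesis .
  qed
  have r\<kappa>_int: "integrable lebesgue (\<lambda>x. of_real (r x) * \<kappa> ((x - b) / a))" if "0 < a" "a \<le> 1" for a
  proof (rule Bochner_Integration.integrable_bound)
    show "integrable lebesgue (\<lambda>x. C * (\<bar>r x\<bar> * w x))" by (intro integrable_mult_right rw)
    show "AE x in lebesgue. norm (of_real (r x) * \<kappa> ((x - b) / a)) \<le> norm (C * (\<bar>r x\<bar> * w x))"
    proof (rule AE_I2)
      fix x
      have "\<bar>x - b\<bar> \<le> \<bar>x - b\<bar> / a" using that by (simp add: pos_le_divide_eq mult_right_le_one_le)
      then have "(1 + \<bar>x - b\<bar>) ^ (N + 3) \<le> (1 + \<bar>(x - b) / a\<bar>) ^ (N + 3)"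
        using that by (intro power_mono) (auto simp: abs_divide)
      then have "C / (1 + \<bar>(x - b) / a\<bar>) ^ (N + 3) \<le> C * w x"
        unfolding w_def times_divide_eq_right mult_1_right
        using C(1) by (intro divide_left_mono) (auto intro!: mult_pos_pos zero_less_power add_pos_nonneg)
      with C(2)[of "(x - b) / a"] have "norm (\<kappa> ((x - b) / a)) \<le> C * w x" by linarith
      then have "\<bar>r x\<bar> * norm (\<kappa> ((x - b) / a)) \<le> \<bar>r x\<bar> * (C * w x)" by (intro mult_left_mono) auto
      then show "norm (of_real (r x) * \<kappa> ((x - b) / a)) \<le> norm (C * (\<bar>r x\<bar> * w x))"
        using C(1) w_pos[of x] by (simp add: norm_mult abs_mult mult_ac)
    qed
  qed (intro borel_measurable_times meas_cr meas_\<kappa>)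
  have subst: "(LINT x|lborel. of_real (h (x - b)) * \<kappa> ((x - b) / a)) = of_real (a powr (\<gamma> + 1)) * L"
    "integrable lborel (\<lambda>x. of_real (h (x - b)) * \<kappa> ((x - b) / a))" if "0 < a" for a
  proof -
    show "(LINT x|lborel. of_real (h (x - b)) * \<kappa> ((x - b) / a)) = of_real (a powr (\<gamma> + 1)) * L"
      using that by (subst lborel_integral_real_affine[of a _ b])
        (auto simp: h_hom mult.assoc L_def powr_add scaleR_conv_of_real)
    show "integrable lborel (\<lambda>x. of_real (h (x - b)) * \<kappa> ((x - b) / a))"
      using that h\<kappa> by (subst lborel_integrable_real_affine_iff[of a _ b, symmetric]) (auto simp: h_hom mult.assoc)
  qed
  have subst_A: "(LINT x|lborel. \<bar>x - b\<bar> powr \<gamma> * norm (\<kappa> ((x - b) / a))) = a powr (\<gamma> + 1) * A"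
    "integrable lborel (\<lambda>x. \<bar>x - b\<bar> powr \<gamma> * norm (\<kappa> ((x - b) / a)))" if "0 < a" for a
  proof -
    show "(LINT x|lborel. \<bar>x - b\<bar> powr \<gamma> * norm (\<kappa> ((x - b) / a))) = a powr (\<gamma> + 1) * A"
      using that by (subst lborel_integral_real_affine[of a _ b]) (auto simp: abs_mult powr_mult mult.assoc A_def powr_add)
    show "integrable lborel (\<lambda>x. \<bar>x - b\<bar> powr \<gamma> * norm (\<kappa> ((x - b) / a)))"
      using that A_int by (subst lborel_integrable_real_affine_iff[of a _ b, symmetric]) (auto simp: abs_mult powr_mult mult.assoc)
  qed
  have decomposition: "a powr (- \<gamma> - 1 / 2) *\<^sub>R regular_distribution (\<lambda>x. of_real (f x)) (wavelet_dilate \<kappa> a b)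
      = L + a powr (- \<gamma> - 1) *\<^sub>R E a" if "0 < a" "a \<le> 1" for a
  proof -
    have "regular_distribution (\<lambda>x. of_real (f x)) (wavelet_dilate \<kappa> a b)
        = (LINT x|lebesgue. of_real (1 / sqrt a) *
            (of_real (h (x - b)) * \<kappa> ((x - b) / a) + of_real (r x) * \<kappa> ((x - b) / a)))"
      unfolding regular_distribution_def wavelet_dilate_def
      by (intro Bochner_Integration.integral_cong) (auto simp: r_def algebra_simps)
    also have "\<dots> = of_real (1 / sqrt a) *
        ((LINT x|lebesgue. of_real (h (x - b)) * \<kappa> ((x - b) / a)) + E a)"
      unfolding E_def using subst(2)[of a] r\<kappa>_int[of a] that
      by (subst integral_mult_right_zero, subst Bochner_Integration.integral_add)
         (auto simp: integrable_completion)
    also have "(LINT x|lebesgue. of_real (h (x - b)) * \<kappa> ((x - b) / a)) = of_real (a powr (\<gamma> + 1)) * L"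
      using subst(1)[of a] that by (subst integral_completion) auto
    also have "1 / sqrt a = a powr (- (1 / 2))"
      using that by (simp only: powr_minus powr_half_sqrt less_imp_le inverse_eq_divide)
    finally have "a powr (- \<gamma> - 1 / 2) *\<^sub>R regular_distribution (\<lambda>x. of_real (f x)) (wavelet_dilate \<kappa> a b)
        = of_real (a powr (- \<gamma> - 1 / 2) * a powr (- (1 / 2))) * (of_real (a powr (\<gamma> + 1)) * L + E a)"
      by (simp add: scaleR_conv_of_real)
    also have "a powr (- \<gamma> - 1 / 2) * a powr (- (1 / 2)) = a powr (- \<gamma> - 1)"
      by (subst powr_add[symmetric]) (simp add: algebra_simps)
    also have "of_real (a powr (- \<gamma> - 1)) * (of_real (a powr (\<gamma> + 1)) * L + E a)
        = of_real (a powr (- \<gamma> - 1) * a powr (\<gamma> + 1)) * L + a powr (- \<gamma> - 1) *\<^sub>R E a"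
      by (simp add: scaleR_conv_of_real algebra_simps)
    also have "a powr (- \<gamma> - 1) * a powr (\<gamma> + 1) = 1"
      using that by (subst powr_add[symmetric]) simp
    finally show ?thesis by simp
  qed
  \<comment> \<open>The two terms are the contributions of the regions inside and outside distance \<open>\<delta>\<close> of \<open>b\<close>.\<close>
  have E_le: "\<exists>\<delta>>0. \<forall>a. 0 < a \<and> a \<le> 1 \<longrightarrow> norm (E a) \<le>
      \<eta> * (a powr (\<gamma> + 1) * A) + C * ((1 + \<delta>) / \<delta>) ^ (N + 3) * a ^ (N + 3) * B" if \<eta>: "0 < \<eta>" for \<eta>
  proof -
    from g[THEN tendstoD, OF \<eta>] obtain \<delta> where \<delta>: "0 < \<delta>"
      and g_le: "\<And>x. x \<noteq> b \<Longrightarrow> \<bar>x - b\<bar> < \<delta> \<Longrightarrow> \<bar>g x\<bar> < \<eta>"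
      by (auto simp: eventually_at dist_real_def)
    have h0: "h 0 = 0" using h_le[of 0] by simp
    have near: "\<bar>r x\<bar> \<le> \<eta> * \<bar>x - b\<bar> powr \<gamma>" if "\<bar>x - b\<bar> < \<delta>" for x
    proof (cases "x = b")
      case False
      have "\<bar>r x\<bar> = \<bar>h (x - b)\<bar> * \<bar>g x\<bar>" by (simp add: r_def fg algebra_simps flip: abs_mult)
      also have "\<dots> \<le> \<bar>x - b\<bar> powr \<gamma> * \<eta>"
        using g_le[OF False that] by (intro mult_mono h_le) auto
      finally show ?thesis by (simp add: mult.commute)
    qed (simp add: r_def fg h0)
    let ?K = "\<lambda>a. C * ((1 + \<delta>) / \<delta>) ^ (N + 3) * a ^ (N + 3)"
    have "norm (E a) \<le> \<eta> * (a powr (\<gamma> + 1) * A) + ?K a * B" if a: "0 < a" "a \<le> 1" for a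
    proof -
      have K: "0 \<le> ?K a" using C(1) a \<delta> by simp
      have i1: "integrable lebesgue (\<lambda>x. \<eta> * (\<bar>x - b\<bar> powr \<gamma> * norm (\<kappa> ((x - b) / a))))"
        using subst_A(2)[of a] a by (intro integrable_mult_right) (auto simp: integrable_completion)
      have i2: "integrable lebesgue (\<lambda>x. ?K a * (\<bar>r x\<bar> * w x))"
        by (intro integrable_mult_right rw)
      have "norm (E a) \<le> (LINT x|lebesgue. norm (of_real (r x) * \<kappa> ((x - b) / a)))"
        unfolding E_def by (rule integral_norm_bound)
      also have "\<dots> \<le> (LINT x|lebesgue. \<eta> * (\<bar>x - b\<bar> powr \<gamma> * norm (\<kappa> ((x - b) / a))) + ?K a * (\<bar>r x\<bar> * w x))"
      proof (rule integral_mono)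
        fix x
        show "norm (of_real (r x) * \<kappa> ((x - b) / a))
            \<le> \<eta> * (\<bar>x - b\<bar> powr \<gamma> * norm (\<kappa> ((x - b) / a))) + ?K a * (\<bar>r x\<bar> * w x)"
        proof (cases "\<bar>x - b\<bar> < \<delta>")
          case True
          have "0 \<le> ?K a * (\<bar>r x\<bar> * w x)"
            by (rule mult_nonneg_nonneg[OF K mult_nonneg_nonneg[OF abs_ge_zero less_imp_le[OF w_pos]]])
          moreover have "\<bar>r x\<bar> * norm (\<kappa> ((x - b) / a)) \<le> \<eta> * \<bar>x - b\<bar> powr \<gamma> * norm (\<kappa> ((x - b) / a))"
            by (intro mult_right_mono near True) auto
          ultimately show ?thesis by (simp only: norm_mult norm_of_real mult.assoc)
        next
          case False
          then have "\<delta> \<le> \<bar>x - b\<bar>" by simp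
          from far[OF a(1) \<delta> this]
          have "\<bar>r x\<bar> * norm (\<kappa> ((x - b) / a)) \<le> \<bar>r x\<bar> * (?K a * w x)"
            by (intro mult_left_mono) auto
          moreover have "0 \<le> \<eta> * (\<bar>x - b\<bar> powr \<gamma> * norm (\<kappa> ((x - b) / a)))" using \<eta> by simp
          ultimately show ?thesis by (simp only: norm_mult norm_of_real mult_ac)
        qed
      qed (use i1 i2 r\<kappa>_int[OF a] in \<open>auto intro: integrable_norm\<close>)
      also have "\<dots> = \<eta> * (a powr (\<gamma> + 1) * A) + ?K a * B"
        using subst_A(1)[OF a(1)] unfolding B_def
        by (subst Bochner_Integration.integral_add[OF i1 i2]) (simp add: integral_completion)
      finally show ?thesis .
    qed
    with \<delta> show ?thesis by blast
  qed
  have "((\<lambda>a. a powr (- \<gamma> - 1) *\<^sub>R E a) \<longlongrightarrow> 0) (at_right 0)"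
  proof (rule tendstoI)
    fix e :: real assume "0 < e"
    \<comment> \<open>The summand \<open>1\<close> avoids a division by zero and makes \<open>\<eta> * A < e / 2\<close> strict.\<close>
    define \<eta> where "\<eta> = e / (2 * (A + 1))"
    have \<eta>: "0 < \<eta>" "\<eta> * A < e / 2"
      using \<open>0 < e\<close> \<open>0 \<le> A\<close> by (auto simp: \<eta>_def field_simps)
    from E_le[OF \<eta>(1)] obtain \<delta> where "0 < \<delta>" and \<delta>: "\<And>a. 0 < a \<Longrightarrow> a \<le> 1 \<Longrightarrow> norm (E a) \<le>
      \<eta> * (a powr (\<gamma> + 1) * A) + C * ((1 + \<delta>) / \<delta>) ^ (N + 3) * a ^ (N + 3) * B" by blast
    define K where "K = C * ((1 + \<delta>) / \<delta>) ^ (N + 3) * B"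
    have "((\<lambda>a. a powr (real N + 2 - \<gamma>)) \<longlongrightarrow> 0 powr (real N + 2 - \<gamma>)) (at_right 0)"
      using \<gamma> by (intro tendsto_powr2 tendsto_intros) (auto intro: eventually_mono[OF eventually_at_right_less])
    then have "((\<lambda>a. K * a powr (real N + 2 - \<gamma>)) \<longlongrightarrow> 0) (at_right 0)"
      by (auto intro: tendsto_mult_right_zero)
    then have "\<forall>\<^sub>F a in at_right 0. K * a powr (real N + 2 - \<gamma>) < e / 2"
      using \<open>0 < e\<close> by (intro order_tendstoD(2)) auto
    moreover have "\<forall>\<^sub>F a in at_right (0::real). 0 < a \<and> a \<le> 1"
      by (rule eventually_mono[OF eventually_at_right_real[of 0 1]]) auto
    ultimately show "\<forall>\<^sub>F a in at_right 0. dist (a powr (- \<gamma> - 1) *\<^sub>R E a) 0 < e"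
    proof eventually_elim
      case (elim a)
      then have a: "0 < a" "a \<le> 1" by auto
      have "norm (a powr (- \<gamma> - 1) *\<^sub>R E a) = a powr (- \<gamma> - 1) * norm (E a)" by simp
      also have "\<dots> \<le> a powr (- \<gamma> - 1) *
          (\<eta> * (a powr (\<gamma> + 1) * A) + C * ((1 + \<delta>) / \<delta>) ^ (N + 3) * a ^ (N + 3) * B)"
        by (intro mult_left_mono \<delta> a) auto
      also have "\<dots> = \<eta> * A * (a powr (- \<gamma> - 1) * a powr (\<gamma> + 1)) + K * (a powr (- \<gamma> - 1) * a powr real (N + 3))"
        unfolding powr_realpow[OF a(1)] K_def by (simp add: algebra_simps)
      also have "\<dots> = \<eta> * A + K * a powr (real N + 2 - \<gamma>)"
        using a by (simp add: algebra_simps flip: powr_add)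
      also have "\<dots> < e" using elim \<eta>(2) by linarith
      finally show ?case by simp
    qed
  qed
  then have "((\<lambda>a. L + a powr (- \<gamma> - 1) *\<^sub>R E a) \<longlongrightarrow> L + 0) (at_right 0)"
    by (intro tendsto_intros)
  moreover have "\<forall>\<^sub>F a in at_right 0. L + a powr (- \<gamma> - 1) *\<^sub>R E a
      = a powr (- \<gamma> - 1 / 2) *\<^sub>R regular_distribution (\<lambda>x. of_real (f x)) (wavelet_dilate \<kappa> a b)"
    by (rule eventually_mono[OF eventually_at_right_real[of 0 1]]) (auto simp: decomposition)
  ultimately have "((\<lambda>a. a powr (- \<gamma> - 1 / 2) *\<^sub>R regular_distribution (\<lambda>x. of_real (f x)) (wavelet_dilate \<kappa> a b))
      \<longlongrightarrow> L + 0) (at_right 0)"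
    by (rule Lim_transform_eventually)
  then show ?thesis by (simp add: L_def)
qed

section \<open>Moments of a wavelet with positive spectrum\<close>

lemma norm_powr_of_real_exponent: "z \<noteq> 0 \<Longrightarrow> norm (z powr (of_real x)) = norm z powr x" for z :: complex
  by (simp add: powr_def)

text \<open>
  The lower bound on the frequencies keeps negative powers of \<open>\<omega>\<close> bounded on the spectrum; the upper
  bound makes the Fourier transform integrable, being bounded as well.
\<close>

locale band_limited =
  fixes \<kappa> :: "real \<Rightarrow> complex" and c d :: real
  assumes wavelet_schwartz: "schwartz \<kappa>" and c_pos: "0 < c"
    and support: "\<And>\<omega>. fourier \<kappa> \<omega> \<noteq> 0 \<Longrightarrow> \<omega> \<in> {c..d}"
begin

lemma measurable_wavelet [measurable]: "\<kappa> \<in> borel_measurable borel"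
  using schwartz_integrable[OF wavelet_schwartz] by auto

lemma measurable_fourier [measurable]: "fourier \<kappa> \<in> borel_measurable borel"
  by (rule borel_measurable_fourier[OF measurable_wavelet])

lemma integrable_fourier_mult:
  assumes [measurable]: "m \<in> borel_measurable borel" and m: "\<And>\<omega>. \<omega> \<in> {c..d} \<Longrightarrow> norm (m \<omega>) \<le> B"
  shows "integrable lborel (\<lambda>\<omega>. fourier \<kappa> \<omega> * m \<omega>)"
proof (rule Bochner_Integration.integrable_bound)
  define A where "A = (LINT y|lborel. norm (\<kappa> y))"
  have A: "norm (fourier \<kappa> \<omega>) \<le> A" for \<omega>
    unfolding fourier_lborel[OF measurable_wavelet] A_def
    by (rule order_trans[OF integral_norm_bound]) (simp add: norm_mult)
  show "integrable lborel (\<lambda>\<omega>. A * B * indicator {c..d} \<omega> :: real)"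
    by (intro integrable_mult_right integrable_real_indicator) (auto simp: emeasure_lborel_Icc_eq)
  have "norm (fourier \<kappa> \<omega> * m \<omega>) \<le> norm (A * B * indicator {c..d} \<omega> :: real)" for \<omega>
  proof (cases "fourier \<kappa> \<omega> = 0")
    case False
    then have \<omega>: "\<omega> \<in> {c..d}" by (rule support)
    have "norm (fourier \<kappa> \<omega> * m \<omega>) \<le> A * B"
      unfolding norm_mult by (intro mult_mono A m[OF \<omega>] order_trans[OF norm_ge_zero A]) auto
    then show ?thesis using \<omega> by simp
  qed simp
  then show "AE \<omega> in lborel. norm (fourier \<kappa> \<omega> * m \<omega>) \<le> norm (A * B * indicator {c..d} \<omega> :: real)"
    by simp
qed measurable

lemma integrable_fourier: "integrable lborel (fourier \<kappa>)"
  using integrable_fourier_mult[of "\<lambda>_. 1" 1] by simp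

lemma inversion: "(LINT \<omega>|lborel. fourier \<kappa> \<omega> * iexp (\<omega> * x)) = 2 * pi * \<kappa> x"
proof (rule fourier_inversion)
  obtain C where "\<And>y. norm (\<kappa> y) \<le> C / (1 + \<bar>y\<bar>) ^ 0"
    using schwartz_decay[OF wavelet_schwartz, of 0] by blast
  then show "bounded (range \<kappa>)" by (auto simp: bounded_iff)
qed (intro schwartz_continuous wavelet_schwartz schwartz_integrable integrable_fourier)+

text \<open>
  Fourier inversion replaces the wavelet by a superposition of exponentials of frequencies in
  \<open>{c..d}\<close>, and each exponential yields one damped gamma integral.
\<close>

lemma damped_moment:
  assumes "0 < p" "0 < \<epsilon>"
  shows "2 * pi * (LINT y|lborel. of_real (pos_part_powr y p * exp (- (\<epsilon> * y))) * \<kappa> y)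
       = of_real (Gamma (p + 1)) * (LINT \<omega>|lborel. fourier \<kappa> \<omega> * Complex \<epsilon> (- \<omega>) powr (- of_real (p + 1)))"
proof -
  let ?u = "\<lambda>y. pos_part_powr y p * exp (- (\<epsilon> * y))"
  have "2 * pi * (LINT y|lborel. of_real (?u y) * \<kappa> y) = (LINT y|lborel. of_real (?u y) * (2 * pi * \<kappa> y))"
    by (subst integral_mult_right_zero[symmetric]) (simp only: mult.left_commute)
  also have "\<dots> = (LINT y|lborel. LINT \<omega>|lborel. of_real (?u y) * (fourier \<kappa> \<omega> * iexp (\<omega> * y)))"
    by (simp only: inversion[symmetric] integral_mult_right_zero)
  also have "\<dots> = (LINT \<omega>|lborel. LINT y|lborel. of_real (?u y) * (fourier \<kappa> \<omega> * iexp (\<omega> * y)))"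
    by (rule Fubini_product_bound[where u = "\<lambda>\<omega>. norm (fourier \<kappa> \<omega>)" and v = ?u])
       (use integrable_fourier integrable_damped_pos_part_powr[OF assms] in \<open>auto simp: norm_mult\<close>)
  also have "\<dots> = (LINT \<omega>|lborel. fourier \<kappa> \<omega> * damped_gamma \<epsilon> p \<omega>)"
    unfolding damped_gamma_def
    by (subst integral_mult_right_zero[symmetric]) (simp only: mult.left_commute)
  also have "\<dots> = (LINT \<omega>|lborel. of_real (Gamma (p + 1)) * (fourier \<kappa> \<omega> * Complex \<epsilon> (- \<omega>) powr (- of_real (p + 1))))"
    by (simp only: damped_gamma_eq[OF assms] mult.left_commute)
  finally show ?thesis by (simp only: integral_mult_right_zero)
qed

text \<open>
  The limit \<open>\<epsilon> \<rightarrow> 0\<close> of the damped moments. The frequencies stay away from zero, so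
  \<open>(\<epsilon> - \<i> \<omega>) powr (- (p + 1))\<close> is bounded by \<open>c powr (- (p + 1))\<close> and converges to
  \<open>(- \<i> \<omega>) powr (- (p + 1))\<close>. Since all frequencies are positive, its phase does not depend on \<open>\<omega>\<close>
  and comes out of the integral.
\<close>

lemma pos_part_moment:
  assumes "0 < p" "p \<le> 1"
  shows "2 * pi * (LINT y|lborel. of_real (pos_part_powr y p) * \<kappa> y)
       = of_real (Gamma (p + 1)) * (iexp ((p + 1) * pi / 2) *
           (LINT \<omega>|lborel. fourier \<kappa> \<omega> * of_real (\<omega> powr (- (p + 1)))))"
proof -
  define \<epsilon> where "\<epsilon> n = inverse (real (Suc n))" for n
  have \<epsilon>: "\<epsilon> \<longlonglongrightarrow> 0" "\<And>n. 0 < \<epsilon> n"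
    unfolding \<epsilon>_def by (rule LIMSEQ_inverse_real_of_nat) simp
  have "(\<lambda>n. LINT y|lborel. of_real (pos_part_powr y p * exp (- (\<epsilon> n * y))) * \<kappa> y)
      \<longlonglongrightarrow> (LINT y|lborel. of_real (pos_part_powr y p) * \<kappa> y)"
  proof (rule integral_dominated_convergence[OF _ _ integrable_schwartz_powr[OF wavelet_schwartz assms]])
    show "AE y in lborel. (\<lambda>n. of_real (pos_part_powr y p * exp (- (\<epsilon> n * y))) * \<kappa> y)
        \<longlonglongrightarrow> of_real (pos_part_powr y p) * \<kappa> y"
      by (intro AE_I2) (auto intro!: tendsto_eq_intros \<epsilon>)
    show "AE y in lborel. norm (of_real (pos_part_powr y p * exp (- (\<epsilon> n * y))) * \<kappa> y)
        \<le> \<bar>y\<bar> powr p * norm (\<kappa> y)" for n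
    proof (rule AE_I2)
      fix y
      have "pos_part_powr y p * exp (- (\<epsilon> n * y)) \<le> \<bar>y\<bar> powr p"
        using \<epsilon>(2)[of n] by (auto simp: pos_part_powr_def mult_left_le)
      then show "norm (of_real (pos_part_powr y p * exp (- (\<epsilon> n * y))) * \<kappa> y) \<le> \<bar>y\<bar> powr p * norm (\<kappa> y)"
        unfolding norm_mult norm_of_real by (intro mult_right_mono) auto
    qed
  qed auto
  then have lhs: "(\<lambda>n. 2 * pi * (LINT y|lborel. of_real (pos_part_powr y p * exp (- (\<epsilon> n * y))) * \<kappa> y))
      \<longlonglongrightarrow> 2 * pi * (LINT y|lborel. of_real (pos_part_powr y p) * \<kappa> y)"
    by (intro tendsto_intros)
  have Complex_eq: "Complex \<epsilon> (- \<omega>) = of_real \<epsilon> - \<i> * of_real \<omega>" for \<epsilon> \<omega>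
    by (simp add: complex_eq_iff)
  have "(\<lambda>n. LINT \<omega>|lborel. fourier \<kappa> \<omega> * Complex (\<epsilon> n) (- \<omega>) powr (- of_real (p + 1)))
      \<longlonglongrightarrow> (LINT \<omega>|lborel. fourier \<kappa> \<omega> * (iexp ((p + 1) * pi / 2) * of_real (\<omega> powr (- (p + 1)))))"
  proof (rule integral_dominated_convergence)
    show "integrable lborel (\<lambda>\<omega>. norm (fourier \<kappa> \<omega> * of_real (c powr (- (p + 1)))))"
      by (intro integrable_norm integrable_fourier_mult[of _ "c powr (- (p + 1))"]) (auto simp: norm_powr_real_powr)
    show "AE \<omega> in lborel. (\<lambda>n. fourier \<kappa> \<omega> * Complex (\<epsilon> n) (- \<omega>) powr (- of_real (p + 1)))
        \<longlonglongrightarrow> fourier \<kappa> \<omega> * (iexp ((p + 1) * pi / 2) * of_real (\<omega> powr (- (p + 1))))"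
    proof (rule AE_I2)
      fix \<omega>
      show "(\<lambda>n. fourier \<kappa> \<omega> * Complex (\<epsilon> n) (- \<omega>) powr (- of_real (p + 1)))
        \<longlonglongrightarrow> fourier \<kappa> \<omega> * (iexp ((p + 1) * pi / 2) * of_real (\<omega> powr (- (p + 1))))"
      proof (cases "fourier \<kappa> \<omega> = 0")
        case False
        then have "0 < \<omega>" using support[of \<omega>] c_pos by auto
        have "(\<lambda>n. Complex (\<epsilon> n) (- \<omega>)) \<longlonglongrightarrow> - (\<i> * of_real \<omega>)"
          unfolding Complex_eq by (auto intro!: tendsto_eq_intros \<epsilon>)
        then have "(\<lambda>n. Complex (\<epsilon> n) (- \<omega>) powr (- of_real (p + 1))) \<longlonglongrightarrow> (- (\<i> * of_real \<omega>)) powr (- of_real (p + 1))"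
          using \<open>0 < \<omega>\<close> by (intro tendsto_powr_complex tendsto_const) (auto simp: complex_nonpos_Reals_iff)
        also have "(- (\<i> * of_real \<omega>)) powr (- of_real (p + 1)) = iexp ((p + 1) * pi / 2) * of_real (\<omega> powr (- (p + 1)))"
        proof -
          have "Ln (- (\<i> * of_real \<omega>)) = Ln (of_real \<omega> * (- \<i>))" by (simp add: mult.commute)
          also have "\<dots> = of_real (ln \<omega>) + Ln (- \<i>)" using \<open>0 < \<omega>\<close> by (subst Ln_times_of_real) (auto simp: Ln_of_real)
          also have "Ln (- \<i>) = - (\<i> * pi / 2)" by simp
          finally have Ln_eq: "Ln (- (\<i> * of_real \<omega>)) = of_real (ln \<omega>) + - (\<i> * pi / 2)" .
          have "(- (\<i> * of_real \<omega>)) powr (- of_real (p + 1))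
              = exp (\<i> * of_real ((p + 1) * pi / 2) + of_real (- (p + 1) * ln \<omega>))"
            unfolding powr_def Ln_eq using \<open>0 < \<omega>\<close> by (simp add: algebra_simps add_divide_distrib diff_divide_distrib)
          also have "\<dots> = iexp ((p + 1) * pi / 2) * of_real (\<omega> powr (- (p + 1)))"
            using \<open>0 < \<omega>\<close> by (simp only: exp_add exp_of_real powr_def) simp
          finally show ?thesis .
        qed
        finally show ?thesis by (intro tendsto_mult tendsto_const)
      qed simp
    qed
    show "AE \<omega> in lborel. norm (fourier \<kappa> \<omega> * Complex (\<epsilon> n) (- \<omega>) powr (- of_real (p + 1)))
        \<le> norm (fourier \<kappa> \<omega> * of_real (c powr (- (p + 1))))" for n
    proof (rule AE_I2)
      fix \<omega>
      show "norm (fourier \<kappa> \<omega> * Complex (\<epsilon> n) (- \<omega>) powr (- of_real (p + 1)))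
        \<le> norm (fourier \<kappa> \<omega> * of_real (c powr (- (p + 1))))"
      proof (cases "fourier \<kappa> \<omega> = 0")
        case False
        then have \<omega>: "c \<le> \<omega>" using support[of \<omega>] by auto
        have "\<bar>Im (Complex (\<epsilon> n) (- \<omega>))\<bar> \<le> norm (Complex (\<epsilon> n) (- \<omega>))" by (rule abs_Im_le_cmod)
        then have le: "c \<le> norm (Complex (\<epsilon> n) (- \<omega>))" using \<omega> c_pos by simp
        have "norm (Complex (\<epsilon> n) (- \<omega>) powr (of_real (- (p + 1)))) = norm (Complex (\<epsilon> n) (- \<omega>)) powr (- (p + 1))"
          using \<epsilon>(2)[of n] by (intro norm_powr_of_real_exponent) (auto simp: complex_eq_iff)
        also have "\<dots> \<le> c powr (- (p + 1))"
          using le c_pos assms by (intro powr_mono2') auto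
        finally show ?thesis
          unfolding norm_mult by (intro mult_left_mono) auto
      qed simp
    qed
    show "(\<lambda>\<omega>. fourier \<kappa> \<omega> * Complex (\<epsilon> n) (- \<omega>) powr (- of_real (p + 1))) \<in> borel_measurable lborel" for n
    proof -
      have [measurable]: "(\<lambda>\<omega>. Complex (\<epsilon> n) (- \<omega>) powr (- of_real (p + 1))) \<in> borel_measurable borel"
        unfolding Complex_eq using \<epsilon>(2)[of n]
        by (intro borel_measurable_continuous_onI continuous_on_powr_complex continuous_intros)
           (auto simp: complex_eq_iff complex_nonpos_Reals_iff)
      show ?thesis by measurable
    qed
  qed measurable
  then have "(\<lambda>n. of_real (Gamma (p + 1)) * (LINT \<omega>|lborel. fourier \<kappa> \<omega> * Complex (\<epsilon> n) (- \<omega>) powr (- of_real (p + 1))))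
      \<longlonglongrightarrow> of_real (Gamma (p + 1)) * (LINT \<omega>|lborel. fourier \<kappa> \<omega> * (iexp ((p + 1) * pi / 2) * of_real (\<omega> powr (- (p + 1)))))"
    by (intro tendsto_intros)
  with lhs have "2 * pi * (LINT y|lborel. of_real (pos_part_powr y p) * \<kappa> y)
      = of_real (Gamma (p + 1)) * (LINT \<omega>|lborel. fourier \<kappa> \<omega> * (iexp ((p + 1) * pi / 2) * of_real (\<omega> powr (- (p + 1)))))"
    unfolding damped_moment[OF assms(1) \<epsilon>(2)] by (rule LIMSEQ_unique)
  also have "(LINT \<omega>|lborel. fourier \<kappa> \<omega> * (iexp ((p + 1) * pi / 2) * of_real (\<omega> powr (- (p + 1)))))
      = iexp ((p + 1) * pi / 2) * (LINT \<omega>|lborel. fourier \<kappa> \<omega> * of_real (\<omega> powr (- (p + 1))))"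
    by (subst integral_mult_right_zero[symmetric]) (simp only: mult.left_commute)
  finally show ?thesis .
qed

text \<open>
  A real spectrum makes reflection act as complex conjugation, so left-hand moments are the
  conjugates of right-hand ones.
\<close>

lemma cnj_wavelet:
  assumes "\<And>\<omega>. fourier \<kappa> \<omega> \<in> \<real>"
  shows "\<kappa> (- y) = cnj (\<kappa> y)"
proof -
  have "2 * pi * cnj (\<kappa> y) = cnj (LINT \<omega>|lborel. fourier \<kappa> \<omega> * iexp (\<omega> * y))"
    unfolding inversion by simp
  also have "\<dots> = (LINT \<omega>|lborel. cnj (fourier \<kappa> \<omega> * iexp (\<omega> * y)))"
    by (rule Bochner_Integration.integral_cnj[symmetric])
  also have "\<dots> = (LINT \<omega>|lborel. fourier \<kappa> \<omega> * iexp (\<omega> * - y))"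
    using assms by (intro Bochner_Integration.integral_cong) (auto simp: exp_cnj Reals_cnj_iff)
  also have "\<dots> = 2 * pi * \<kappa> (- y)" by (rule inversion)
  finally show ?thesis by simp
qed

text \<open>
  The integrand is nonnegative; if its integral vanished, the transform would vanish almost
  everywhere and inversion would give a zero wavelet.
\<close>

lemma spectral_integral_pos:
  assumes nonneg: "\<And>\<omega>. fourier \<kappa> \<omega> \<in> \<real>\<^sub>\<ge>\<^sub>0" and nonzero: "\<kappa> x \<noteq> 0" and "0 \<le> q"
  shows "\<exists>J>0. (LINT \<omega>|lborel. fourier \<kappa> \<omega> * of_real (\<omega> powr (- q))) = of_real J"
proof -
  define k where "k \<omega> = Re (fourier \<kappa> \<omega>) * \<omega> powr (- q)" for \<omega>
  have k_eq: "fourier \<kappa> \<omega> * of_real (\<omega> powr (- q)) = of_real (k \<omega>)" for \<omega>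
    using nonneg[of \<omega>] by (auto simp: k_def complex_eq_iff complex_nonneg_Reals_iff)
  have k_nonneg: "0 \<le> k \<omega>" for \<omega>
    using nonneg[of \<omega>] by (simp add: k_def complex_nonneg_Reals_iff)
  have "integrable lborel (\<lambda>\<omega>. fourier \<kappa> \<omega> * of_real (\<omega> powr (- q)))"
  proof (rule integrable_fourier_mult[of _ "c powr (- q)"])
    show "norm (complex_of_real (\<omega> powr (- q))) \<le> c powr (- q)" if "\<omega> \<in> {c..d}" for \<omega>
      using that c_pos \<open>0 \<le> q\<close> by (auto intro: powr_mono2')
  qed measurable
  then have k_int: "integrable lborel k"
    unfolding k_eq by (simp only: complex_of_real_integrable_eq)
  have "0 < (LINT \<omega>|lborel. k \<omega>)"
  proof (rule ccontr)
    assume "\<not> 0 < (LINT \<omega>|lborel. k \<omega>)"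
    moreover have "0 \<le> (LINT \<omega>|lborel. k \<omega>)" by (simp add: k_nonneg)
    ultimately have "(LINT \<omega>|lborel. k \<omega>) = 0" by linarith
    then have "AE \<omega> in lborel. k \<omega> = 0"
      using integral_nonneg_eq_0_iff_AE[OF k_int] k_nonneg by simp
    then have "AE \<omega> in lborel. fourier \<kappa> \<omega> * iexp (\<omega> * x) = 0"
    proof (rule AE_mp, intro AE_I2 impI)
      fix \<omega> assume "k \<omega> = 0"
      with k_eq[of \<omega>] have "fourier \<kappa> \<omega> = 0 \<or> \<omega> = 0" by simp
      moreover have "fourier \<kappa> 0 = 0" using support[of 0] c_pos by fastforce
      ultimately show "fourier \<kappa> \<omega> * iexp (\<omega> * x) = 0" by auto
    qed
    then have "(LINT \<omega>|lborel. fourier \<kappa> \<omega> * iexp (\<omega> * x)) = 0"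
      by (rule integral_eq_zero_AE)
    with nonzero show False unfolding inversion by simp
  qed
  then show ?thesis unfolding k_eq integral_complex_of_real by blast
qed

lemma pos_part_moment_polar:
  assumes "\<And>\<omega>. fourier \<kappa> \<omega> \<in> \<real>\<^sub>\<ge>\<^sub>0" and "\<kappa> x \<noteq> 0" and "0 < p" "p \<le> 1"
  shows "\<exists>P>0. (LINT y|lborel. of_real (pos_part_powr y p) * \<kappa> y) = of_real P * iexp ((p + 1) * pi / 2)"
proof -
  obtain J where J: "0 < J" "(LINT \<omega>|lborel. fourier \<kappa> \<omega> * of_real (\<omega> powr (- (p + 1)))) = of_real J"
    using spectral_integral_pos[OF assms(1,2), of "p + 1"] assms(3) by auto
  show ?thesis
  proof (intro exI conjI)
    show "0 < Gamma (p + 1) * J / (2 * pi)"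
      using J assms(3) by (simp add: Gamma_real_pos)
    show "(LINT y|lborel. of_real (pos_part_powr y p) * \<kappa> y) = of_real (Gamma (p + 1) * J / (2 * pi)) * iexp ((p + 1) * pi / 2)"
      using pos_part_moment[OF assms(3,4)] unfolding J by (simp add: field_simps)
  qed
qed

lemma reflected_moment:
  assumes "\<And>\<omega>. fourier \<kappa> \<omega> \<in> \<real>"
  shows "(LINT y|lborel. of_real (pos_part_powr (- y) p) * \<kappa> y) = cnj (LINT y|lborel. of_real (pos_part_powr y p) * \<kappa> y)"
proof -
  have "(LINT y|lborel. of_real (pos_part_powr (- y) p) * \<kappa> y)
      = \<bar>- 1\<bar> *\<^sub>R (LINT y|lborel. of_real (pos_part_powr (- (0 + - 1 * y)) p) * \<kappa> (0 + - 1 * y))"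
    by (rule lborel_integral_real_affine) simp
  also have "\<dots> = (LINT y|lborel. cnj (of_real (pos_part_powr y p) * \<kappa> y))"
    by (simp add: cnj_wavelet[OF assms])
  also have "\<dots> = cnj (LINT y|lborel. of_real (pos_part_powr y p) * \<kappa> y)"
    by (rule Bochner_Integration.integral_cnj)
  finally show ?thesis .
qed

end

section \<open>Signatures of cusps\<close>

text \<open>
  Positive rescaling does not change \<open>sgn\<close>, and \<open>sgn\<close> is continuous away from zero: this is why the
  leading coefficient of the pairings must be shown to be nonzero.
\<close>

lemma signature_eq_sgn:
  assumes lim: "((\<lambda>a. a powr q *\<^sub>R u (wavelet_dilate \<kappa> a b)) \<longlongrightarrow> L) (at_right 0)" and "L \<noteq> 0"
  shows "signature \<kappa> u b = sgn L"
proof -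
  have "((\<lambda>a. sgn (a powr q *\<^sub>R u (wavelet_dilate \<kappa> a b))) \<longlongrightarrow> sgn L) (at_right 0)"
    using assms by (rule tendsto_sgn)
  moreover have "\<forall>\<^sub>F a in at_right (0::real). 0 < a" by (rule eventually_at_right_less)
  then have "\<forall>\<^sub>F a in at_right 0. sgn (a powr q *\<^sub>R u (wavelet_dilate \<kappa> a b)) = sgn (u (wavelet_dilate \<kappa> a b))"
    by eventually_elim (simp add: sgn_scaleR)
  ultimately have "((\<lambda>a. sgn (u (wavelet_dilate \<kappa> a b))) \<longlongrightarrow> sgn L) (at_right 0)"
    by (rule Lim_transform_eventually)
  then show ?thesis
    unfolding signature_def by (auto intro!: tendsto_Lim)
qed

theorem theorem4p3:
  fixes \<kappa> :: "real \<Rightarrow> complex" and f :: "real \<Rightarrow> real" and b \<gamma> :: real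
  assumes "signature_wavelet \<kappa>"
    and "locally_integrable f" and "polynomial_growth f"
    and "0 < \<gamma>" and "\<gamma> \<le> 1"
  defines "\<sigma> \<equiv> signature \<kappa> (regular_distribution (\<lambda>x. complex_of_real (f x)))"
  shows "(upward_cusp f \<gamma> b \<longrightarrow> \<sigma> b = 1) \<and>
         (downward_cusp f \<gamma> b \<longrightarrow> \<sigma> b = - 1) \<and>
         (right_hand_cusp f \<gamma> b \<longrightarrow> \<sigma> b = exp (\<i> * of_real ((\<gamma> + 1) * pi / 2))) \<and>
         (left_hand_cusp f \<gamma> b \<longrightarrow> \<sigma> b = exp (- \<i> * of_real ((\<gamma> + 1) * pi / 2)))"
proof -
  obtain c d x where \<kappa>: "schwartz \<kappa>" and x: "\<kappa> x \<noteq> 0" and "0 < c"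
    and supp: "closure {\<omega>. fourier \<kappa> \<omega> \<noteq> 0} \<subseteq> {c..d}"
    and nonneg: "\<And>\<omega>. fourier \<kappa> \<omega> \<in> \<real>\<^sub>\<ge>\<^sub>0"
    using assms(1) unfolding signature_wavelet_def by blast
  interpret band_limited \<kappa> c d
  proof
    fix \<omega> assume "fourier \<kappa> \<omega> \<noteq> 0"
    then have "\<omega> \<in> {\<omega>. fourier \<kappa> \<omega> \<noteq> 0}" by simp
    then have "\<omega> \<in> closure {\<omega>. fourier \<kappa> \<omega> \<noteq> 0}"
      by (rule closure_subset[THEN subsetD])
    with supp show "\<omega> \<in> {c..d}" by (rule subsetD)
  qed fact+
  have real: "fourier \<kappa> \<omega> \<in> \<real>" for \<omega>
    using nonneg[of \<omega>] nonneg_Reals_subset_Reals by blast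
  let ?\<theta> = "(\<gamma> + 1) * pi / 2"
  define right where "right = (LINT y|lborel. of_real (pos_part_powr y \<gamma>) * \<kappa> y)"
  define left where "left = (LINT y|lborel. of_real (pos_part_powr (- y) \<gamma>) * \<kappa> y)"
  obtain P where P: "0 < P" "right = of_real P * iexp ?\<theta>"
    using pos_part_moment_polar[OF nonneg x assms(4,5)] unfolding right_def by blast
  have left: "left = of_real P * iexp (- ?\<theta>)"
    unfolding left_def reflected_moment[OF real] right_def[symmetric] P
    by (simp add: exp_cnj)
  have sgn_P: "sgn (of_real P * iexp t) = iexp t" for t
    using P(1) by (simp add: sgn_mult sgn_of_real sgn_eq[of "iexp t"])
  have int: "integrable lborel (\<lambda>y. of_real (pos_part_powr (s * y) \<gamma>) * \<kappa> y)" if "s \<in> {1, -1}" for s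
    using that by (intro Bochner_Integration.integrable_bound[OF integrable_schwartz_powr[OF \<kappa> assms(4,5)]])
       (auto simp: norm_mult pos_part_powr_def intro!: mult_right_mono)
  have "(LINT y|lborel. of_real (\<bar>y\<bar> powr \<gamma>) * \<kappa> y)
      = (LINT y|lborel. of_real (pos_part_powr (1 * y) \<gamma>) * \<kappa> y + of_real (pos_part_powr (- 1 * y) \<gamma>) * \<kappa> y)"
    by (intro Bochner_Integration.integral_cong) (auto simp: pos_part_powr_def)
  also have "\<dots> = right + left"
    by (subst Bochner_Integration.integral_add[OF int int]) (auto simp: right_def left_def)
  also have "\<dots> = of_real (2 * P * cos ?\<theta>)"
    unfolding P left by (simp add: complex_eq_iff Re_exp Im_exp)
  finally have both: "(LINT y|lborel. of_real (\<bar>y\<bar> powr \<gamma>) * \<kappa> y) = of_real (2 * P * cos ?\<theta>)" .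
  \<comment> \<open>The angle lies in \<open>{pi / 2<..pi}\<close>, so a downward cusp has negative signature.\<close>
  have cos_neg: "cos ?\<theta> < 0"
  proof -
    have "\<gamma> * pi \<le> 1 * pi" using assms(5) by (intro mult_right_mono) auto
    then show ?thesis using assms(4) by (intro cos_lt_zero_pi) (auto simp: field_simps)
  qed
  have key: "\<sigma> b = sgn (LINT y|lborel. of_real (h y) * \<kappa> y)"
    if "(LINT y|lborel. of_real (h y) * \<kappa> y) \<noteq> 0"
      and "h \<in> borel_measurable borel" "\<And>y. \<bar>h y\<bar> \<le> \<bar>y\<bar> powr \<gamma>"
      and "\<And>a y. 0 < a \<Longrightarrow> h (a * y) = a powr \<gamma> * h y"
      and "\<exists>g. locally_integrable g \<and> (g \<longlongrightarrow> 0) (at b) \<and> (\<forall>x. f x = h (x - b) * (1 + g x))" for h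
    using that unfolding \<sigma>_def
    by (auto intro!: signature_eq_sgn pairing_asymptotics[OF \<kappa> assms(4,5,2,3)])
  show ?thesis
  proof (intro conjI impI)
    assume "upward_cusp f \<gamma> b"
    then have "\<sigma> b = sgn (LINT y|lborel. of_real (- (\<bar>y\<bar> powr \<gamma>)) * \<kappa> y)"
      using both P(1) cos_neg by (intro key) (auto simp: upward_cusp_def abs_mult powr_mult)
    also have "(LINT y|lborel. of_real (- (\<bar>y\<bar> powr \<gamma>)) * \<kappa> y) = of_real (- (2 * P * cos ?\<theta>))"
      using both by simp
    finally show "\<sigma> b = 1"
      unfolding sgn_of_real using P(1) cos_neg by (simp add: mult_pos_neg)
  next
    assume "downward_cusp f \<gamma> b"
    then have "\<sigma> b = sgn (LINT y|lborel. of_real (\<bar>y\<bar> powr \<gamma>) * \<kappa> y)"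
      using both P(1) cos_neg by (intro key) (auto simp: downward_cusp_def abs_mult powr_mult)
    then show "\<sigma> b = - 1"
      unfolding both sgn_of_real using P(1) cos_neg by (simp add: mult_pos_neg)
  next
    assume "right_hand_cusp f \<gamma> b"
    then have "\<sigma> b = sgn right"
      unfolding right_def using P
      by (intro key) (auto simp: right_hand_cusp_def pos_part_powr_scale pos_part_powr_le simp flip: right_def)
    then show "\<sigma> b = exp (\<i> * of_real ?\<theta>)"
      unfolding P sgn_P .
  next
    assume "left_hand_cusp f \<gamma> b"
    then have "\<sigma> b = sgn left"
      unfolding left_def using P(1) left pos_part_powr_scale[of _ "- _" \<gamma>] pos_part_powr_le[of "- _" \<gamma>]
      by (intro key) (auto simp: left_hand_cusp_def simp flip: left_def)
    then show "\<sigma> b = exp (- \<i> * of_real ?\<theta>)"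
      unfolding left sgn_P by simp
  qed
qed

end
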